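(* Let $S$ be a countable set and let $\mu$ be a t-stable probability measure on $\{0,1,2,\dots\}^S$. Then $\mu$ is negatively associated.
   Context: Let $\mathbb{N}=\{0,1,2,\dots\}$. A polynomial $f\in\mathbb{C}[x_1,\dots,x_n]$ is stable if $f(x_1,\dots,x_n)\ne 0$ whenever $\operatorname{Im}(x_j)>0$ for all $j$. A function $f$ on $\mathbb{C}^n$ is t-stable (transcendental stable) if there are stable polynomials $f_m$ with $f_m\to f$ uniformly on all compact subsets of $\mathbb{C}^n$. A probability measure $\mu$ on $\mathbb{N}^n$ is t-stable if its generating function $\sum_{i_1,\dots,i_n\ge 0}\mu(i_1,\dots,i_n)x_1^{i_1}\cdots x_n^{i_n}$ is (the power series of) a t-stable function on $\mathbb{C}^n$. For countable $S$, a probability measure on $\mathbb{N}^S$ is t-stable if each of its projections (marginals) onto a finite subset of coordinates is t-stable. A probability measure $\mu$ on $\mathbb{N}^S$ (product topology, coordinatewise partial order) is negatively associated (NA) if $\int FG\,d\mu\le\int F\,d\mu\int G\,d\mu$ for all increasing continuous real-valued functions $F,G$ depending on disjoint sets of coordinates, for which the three integrals exist and are finite. *)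

theory Defs
  imports "HOL-Probability.Probability" "HOL-Library.Poly_Mapping"
begin

text \<open>Polynomials with complex coefficients in variables indexed by \<open>'s\<close> are finitely supported
  maps from monomials (finitely supported exponent maps) to coefficients. The ring
  \<open>\<complex>[x\<^sub>s : s \<in> T]\<close> is the set of all \<open>p\<close> with \<open>mpoly_vars p \<subseteq> T\<close>.\<close>

type_synonym 's cmpoly = "('s \<Rightarrow>\<^sub>0 nat) \<Rightarrow>\<^sub>0 complex"

definition mpoly_vars :: "'s cmpoly \<Rightarrow> 's set" where
  "mpoly_vars p = (\<Union>m\<in>Poly_Mapping.keys p. Poly_Mapping.keys m)"

definition mpoly_eval :: "'s cmpoly \<Rightarrow> ('s \<Rightarrow> complex) \<Rightarrow> complex" where
  "mpoly_eval p x =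
     (\<Sum>m\<in>Poly_Mapping.keys p. Poly_Mapping.lookup p m *
        (\<Prod>s\<in>Poly_Mapping.keys m. x s ^ Poly_Mapping.lookup m s))"

text \<open>Throughout, the space \<open>X\<^sup>T\<close> of \<open>T\<close>-indexed families is \<open>T \<rightarrow>\<^sub>E X\<close>, that is, functions
  that take the value \<open>undefined\<close> outside \<open>T\<close>.\<close>

definition stable_poly :: "'s set \<Rightarrow> 's cmpoly \<Rightarrow> bool" where
  "stable_poly T p \<longleftrightarrow>
     mpoly_vars p \<subseteq> T \<and> (\<forall>x \<in> T \<rightarrow>\<^sub>E UNIV. (\<forall>s\<in>T. Im (x s) > 0) \<longrightarrow> mpoly_eval p x \<noteq> 0)"

definition tstable_fun :: "'s set \<Rightarrow> (('s \<Rightarrow> complex) \<Rightarrow> complex) \<Rightarrow> bool" where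
  "tstable_fun T f \<longleftrightarrow>
     (\<exists>p :: nat \<Rightarrow> 's cmpoly.
        (\<forall>m. stable_poly T (p m)) \<and>
        (\<forall>K. compactin (product_topology (\<lambda>_. euclidean) T) K \<longrightarrow>
             uniform_limit K (\<lambda>m. mpoly_eval (p m)) f sequentially))"

text \<open>The generating function of \<open>\<nu>\<close> is required to converge (unconditionally, hence absolutely)
  to the t-stable function \<open>f\<close> at every point of \<open>\<complex>\<^sup>T\<close>; as \<open>f\<close> is entire, this says exactly
  that it is the power series of \<open>f\<close>.\<close>

definition tstable_measure_fin :: "'s set \<Rightarrow> ('s \<Rightarrow> nat) measure \<Rightarrow> bool" where
  "tstable_measure_fin T \<nu> \<longleftrightarrow>
     (\<exists>f. tstable_fun T f \<and>
        (\<forall>x \<in> T \<rightarrow>\<^sub>E UNIV.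
           ((\<lambda>i. complex_of_real (measure \<nu> {i}) * (\<Prod>s\<in>T. x s ^ i s)) has_sum f x)
             (T \<rightarrow>\<^sub>E (UNIV :: nat set))))"

text \<open>For countable \<open>S\<close>, the product \<open>\<sigma>\<close>-algebra used here is the Borel \<open>\<sigma>\<close>-algebra of the
  product topology on \<open>\<nat>\<^sup>S\<close>.\<close>

abbreviation nat_families :: "'s set \<Rightarrow> ('s \<Rightarrow> nat) measure" where
  "nat_families S \<equiv> PiM S (\<lambda>_. count_space UNIV)"

definition tstable_measure :: "'s set \<Rightarrow> ('s \<Rightarrow> nat) measure \<Rightarrow> bool" where
  "tstable_measure S \<mu> \<longleftrightarrow>
     (\<forall>T. finite T \<and> T \<subseteq> S \<longrightarrow>
        tstable_measure_fin T (distr \<mu> (nat_families T) (\<lambda>\<omega>. restrict \<omega> T)))"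

definition depends_only_on :: "'s set \<Rightarrow> 's set \<Rightarrow> (('s \<Rightarrow> nat) \<Rightarrow> real) \<Rightarrow> bool" where
  "depends_only_on S A F \<longleftrightarrow>
     (\<forall>x \<in> S \<rightarrow>\<^sub>E UNIV. \<forall>y \<in> S \<rightarrow>\<^sub>E UNIV. (\<forall>s\<in>A. x s = y s) \<longrightarrow> F x = F y)"

text \<open>On \<open>S \<rightarrow>\<^sub>E UNIV\<close> the pointwise order of functions is the coordinatewise order over \<open>S\<close>,
  since all members agree outside \<open>S\<close>.\<close>

definition negatively_associated :: "'s set \<Rightarrow> ('s \<Rightarrow> nat) measure \<Rightarrow> bool" where
  "negatively_associated S \<mu> \<longleftrightarrow>
     (\<forall>F G :: ('s \<Rightarrow> nat) \<Rightarrow> real. \<forall>A B.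
        A \<subseteq> S \<and> B \<subseteq> S \<and> A \<inter> B = {} \<and>
        depends_only_on S A F \<and> depends_only_on S B G \<and>
        mono_on (S \<rightarrow>\<^sub>E UNIV) F \<and> mono_on (S \<rightarrow>\<^sub>E UNIV) G \<and>
        continuous_map (product_topology (\<lambda>_. discrete_topology UNIV) S) euclideanreal F \<and>
        continuous_map (product_topology (\<lambda>_. discrete_topology UNIV) S) euclideanreal G \<and>
        integrable \<mu> F \<and> integrable \<mu> G \<and> integrable \<mu> (\<lambda>x. F x * G x) \<longrightarrow>
        (\<integral>x. F x * G x \<partial>\<mu>) \<le> (\<integral>x. F x \<partial>\<mu>) * (\<integral>x. G x \<partial>\<mu>))"

end

theory Submission
  imports Defs "HOL-Complex_Analysis.Complex_Analysis"
    "HOL-Computational_Algebra.Fundamental_Theorem_Algebra"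
begin

text \<open>Let \<open>H\<close> be the upper half plane. The proof transports the statement to weights on the power set of
a finite set, where negative association is proved by an induction of Feder and Mihail.

\<^emph>\<open>Reduction to stable multiaffine polynomials.\<close> Let \<open>T\<close> be finite and let
\<open>f = \<Sum>\<^sub>i a i x^i\<close> be the t-stable generating function of a measure on \<open>\<nat>\<^sup>T\<close>. Give every site of \<open>T\<close>
\<open>N\<close> slots, each slot \<open>e\<close> with a variable \<open>z\<^sub>e\<close>, and apply to \<open>f\<close> the operators
\<open>1 + (z\<^sub>e / N) \<partial>/\<partial>y\<^sub>s\<close> for all slots \<open>e\<close> of all sites \<open>s\<close>; then put \<open>y = 0\<close>. For \<open>z\<^sub>e \<in> H\<close> such an
operator preserves stability of polynomials, because the logarithmic derivative of a polynomial without
zeros in \<open>H\<close> maps \<open>H\<close> to the closed lower half plane. Hence the result is, by Hurwitz' theorem, a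
multiaffine polynomial in \<open>z\<close> without zeros in \<open>H\<close>-tuples; the coefficient of the monomial of a set
\<open>U\<close> of slots is \<open>a k \<Prod>\<^sub>s k\<^sub>s! / N^|U|\<close>, where \<open>k\<^sub>s\<close> counts the slots of site \<open>s\<close> in \<open>U\<close>. Summed over all \<open>U\<close>
with given \<open>k\<close>, this is \<open>a k\<close> times a factor in \<open>[0, 1]\<close> that tends to \<open>1\<close> as \<open>N\<close> grows. So negative
association of the weights on sets of slots yields that of the measure, by dominated convergence
(\<open>finite_negatively_associated\<close>). The coefficients of the approximating polynomials converge to those of
\<open>f\<close> by Cauchy's estimate (\<open>tstable_fun_coefficients\<close>).

\<^emph>\<open>Negative association of stable weights.\<close> Let \<open>w > 0\<close> on the subsets of \<open>E\<close> have a stable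
generating polynomial, and let \<open>X\<^sub>e\<close> be the indicator of \<open>e\<close>. Three facts carry the argument.
(1) \<open>Cov(X\<^sub>e, X\<^sub>f) \<le> 0\<close>: otherwise a Moebius map of \<open>H\<close> produces a zero. (2) \<open>Cov(X\<^sub>e, |U|) \<ge> 0\<close>: on the
diagonal the polynomial is \<open>a(t) + z b(t)\<close>, and \<open>a / b + t\<close> maps the slit plane \<open>\<complex> - (-\<infinity>, 0]\<close> to
itself, so the Schwarz-Pick inequality bounds its derivative at \<open>1\<close>. (3) For nonempty \<open>E\<close> and increasing \<open>F\<close> some
\<open>e \<in> E\<close> has \<open>Cov(X\<^sub>e, F) \<ge> 0\<close>. This holds because \<open>Cov(|U|, F) > 0\<close> for strictly increasing \<open>F\<close>: along
the external field \<open>r^|U| w(U)\<close> the covariance is positive for small \<open>r\<close>, and it cannot vanish, since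
then some \<open>Cov(X\<^sub>e, F)\<close> is nonnegative and conditioning on \<open>X\<^sub>e\<close>, with (2) and induction, makes it positive.
With (1) and (3), conditioning on a well chosen \<open>X\<^sub>f\<close> proves \<open>Cov(F, G) \<le> 0\<close> by induction on the number
of elements on which \<open>F\<close> depends (\<open>positive_stable_negatively_associated\<close>).

\<^emph>\<open>Infinitely many coordinates.\<close> Setting all coordinates outside a finite set to zero decreases
\<open>F\<close> and \<open>G\<close>, and by continuity they are recovered as the finite set grows; monotonicity also
provides the dominating functions.\<close>

section \<open>Univariate complex analysis\<close>

text \<open>The logarithmic derivative is the sum of the terms \<open>1 / (y - r)\<close> over the roots \<open>r\<close>, and each term lies
in the closed lower half plane because \<open>y - r\<close> lies in the upper one.\<close>

lemma Im_logderiv_nonpos: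
  fixes q :: "complex poly"
  assumes "\<And>z. Im z > 0 \<Longrightarrow> poly q z \<noteq> 0" and "Im y > 0"
  shows "Im (poly (pderiv q) y / poly q y) \<le> 0"
  using assms(1)
proof (induction "degree q" arbitrary: q)
  case 0
  then obtain a where "q = [:a:]" by (metis degree_eq_zeroE)
  then show ?case by simp
next
  case (Suc n)
  then obtain r where r: "poly q r = 0"
    using alg_closed_imp_poly_has_root[of q] by (metis zero_less_Suc)
  then obtain h where h: "q = [:- r, 1:] * h" by (metis dvdE poly_eq_0_iff_dvd)
  have "Im r \<le> 0" using Suc.prems r by (meson not_le)
  have nz: "poly h z \<noteq> 0" if "Im z > 0" for z using Suc.prems[OF that] h by auto
  have "h \<noteq> 0" using nz[OF \<open>Im y > 0\<close>] by auto
  then have "n = degree h" using Suc.hyps(2) unfolding h by (subst (asm) degree_mult_eq) auto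
  then have IH: "Im (poly (pderiv h) y / poly h y) \<le> 0" using Suc.hyps(1) nz by blast
  have yr: "y \<noteq> r" using \<open>Im r \<le> 0\<close> assms(2) by auto
  have "poly (pderiv q) y = (y - r) * poly (pderiv h) y + poly h y"
    unfolding h pderiv_mult by (simp add: pderiv_pCons algebra_simps)
  moreover have "poly q y = (y - r) * poly h y" unfolding h by (simp add: algebra_simps)
  ultimately have "poly (pderiv q) y / poly q y = poly (pderiv h) y / poly h y + 1 / (y - r)"
    using yr nz[OF assms(2)] by (simp add: add_divide_distrib)
  moreover have "Im (1 / (y - r)) \<le> 0"
    using \<open>Im r \<le> 0\<close> assms(2) by (simp add: Im_divide divide_nonpos_nonneg)
  ultimately show ?case using IH by simp
qed

text \<open>A zero would force the logarithmic derivative to equal \<open>- 1 / c\<close>, which lies in the upper half plane.\<close>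

lemma poly_add_smult_pderiv_nonzero:
  fixes q :: "complex poly"
  assumes nz: "\<And>z. Im z > 0 \<Longrightarrow> poly q z \<noteq> 0" and y: "Im y > 0" and c: "Im c > 0"
  shows "poly q y + c * poly (pderiv q) y \<noteq> 0"
proof
  assume eq: "poly q y + c * poly (pderiv q) y = 0"
  have "c \<noteq> 0" using c by auto
  then have "poly (pderiv q) y / poly q y = - (1 / c)"
    using eq nz[OF y] by (simp add: field_simps add_eq_0_iff)
  moreover have "Im (- (1 / c)) > 0"
    using c by (simp add: Im_divide) (intro divide_pos_pos, auto simp: sum_power2_gt_zero_iff)
  ultimately show False using Im_logderiv_nonpos[OF nz y] by simp
qed

lemma norm_Cayley_less_1:
  fixes u :: complex and c :: real
  assumes "Re u > 0" "c > 0"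
  shows "norm ((u - of_real c) / (u + of_real c)) < 1"
proof -
  have "norm (u - of_real c)^2 < norm (u + of_real c)^2"
    unfolding cmod_power2 using assms by (simp add: power2_eq_square algebra_simps)
  then have "norm (u - of_real c) < norm (u + of_real c)"
    by (rule power_less_imp_less_base) simp
  then show ?thesis by (simp add: norm_divide divide_less_eq)
qed

text \<open>The square root identifies the slit plane with the right half plane and a Cayley transform
identifies the latter with the unit disc, so that the Schwarz lemma applies to the conjugate of \<open>Q\<close>. The
factor \<open>2\<close> from differentiating \<open>s\<^sup>2\<close> at \<open>1\<close> cancels against that from the square root.\<close>

lemma Schwarz_Pick_slit_plane:
  fixes Q :: "complex \<Rightarrow> complex"
  assumes hol: "Q holomorphic_on - \<real>\<^sub>\<le>\<^sub>0"
    and img: "\<And>t. t \<notin> \<real>\<^sub>\<le>\<^sub>0 \<Longrightarrow> Q t \<notin> \<real>\<^sub>\<le>\<^sub>0"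
    and one: "Q 1 = of_real q" and q: "q > 0"
  shows "norm (deriv Q 1) \<le> q"
proof -
  define c where "c = sqrt q"
  have c: "c > 0" "c^2 = q" using q by (auto simp: c_def)
  define s where "s \<zeta> = (1 + \<zeta>) / (1 - \<zeta>)" for \<zeta> :: complex
  define \<phi> where "\<phi> \<zeta> = (csqrt (Q (s \<zeta> ^ 2)) - of_real c) / (csqrt (Q (s \<zeta> ^ 2)) + of_real c)"
    for \<zeta>
  have Res: "Re (s \<zeta>) > 0" if "norm \<zeta> < 1" for \<zeta>
  proof -
    have "norm \<zeta> ^ 2 < 1" using that by (simp add: power_less_one_iff abs_square_less_1)
    then have "Re \<zeta> ^ 2 + Im \<zeta> ^ 2 < 1" by (simp add: cmod_power2)
    moreover have "1 - \<zeta> \<noteq> 0" using that by auto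
    then have "(1 - Re \<zeta>)\<^sup>2 + (Im \<zeta>)\<^sup>2 > 0"
      by (metis complex_neq_0 minus_complex.simps one_complex.simps power2_minus diff_0)
    ultimately show ?thesis
      unfolding s_def by (simp add: Re_divide power2_eq_square algebra_simps)
  qed
  have slit: "z^2 \<notin> \<real>\<^sub>\<le>\<^sub>0" if "Re z > 0" for z :: complex
  proof
    assume "z^2 \<in> \<real>\<^sub>\<le>\<^sub>0"
    then have "2 * Re z * Im z = 0" "Re z ^2 - Im z ^2 \<le> 0"
      by (auto simp: complex_nonpos_Reals_iff Re_power2 Im_power2)
    then show False using that by auto
  qed
  have Qs: "Q (s \<zeta> ^ 2) \<notin> \<real>\<^sub>\<le>\<^sub>0" if "norm \<zeta> < 1" for \<zeta> using img slit Res that by blast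
  have Repos: "Re (csqrt (Q (s \<zeta> ^ 2))) > 0" if "norm \<zeta> < 1" for \<zeta>
    using Qs[OF that] 
    by (metis csqrt_principal complex_nonpos_Reals_iff less_eq_real_def power2_csqrt mult_zero_left Re_power2 Im_power2
        diff_0 mult_zero_right neg_le_0_iff_le zero_le_power2 zero_power2)
  have nz: "csqrt (Q (s \<zeta> ^ 2)) + of_real c \<noteq> 0" if "norm \<zeta> < 1" for \<zeta>
  proof
    assume "csqrt (Q (s \<zeta> ^ 2)) + of_real c = 0"
    then have "Re (csqrt (Q (s \<zeta> ^ 2)) + of_real c) = 0" by (simp only: zero_complex.simps)
    then show False using Repos[OF that] c(1) by (simp del: csqrt.simps)
  qed
  have s_hol: "s holomorphic_on ball 0 1"
    unfolding s_def by (intro holomorphic_intros) auto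
  have "(Q \<circ> (\<lambda>\<zeta>. s \<zeta> ^ 2)) holomorphic_on ball 0 1"
    by (rule holomorphic_on_compose_gen[OF _ hol])
       (use s_hol slit Res in \<open>auto intro!: holomorphic_intros\<close>)
  then have Qs_hol: "(\<lambda>\<zeta>. Q (s \<zeta> ^ 2)) holomorphic_on ball 0 1" by (simp add: o_def)
  have \<phi>_hol: "\<phi> holomorphic_on ball 0 1"
    unfolding \<phi>_def using nz Qs by (intro holomorphic_intros Qs_hol) auto
  have cs: "csqrt (Q 1) = of_real c" unfolding one c_def using q by (simp add: csqrt_of_real_nonneg)
  have \<phi>0: "\<phi> 0 = 0" by (simp add: \<phi>_def s_def cs)
  have \<phi>lt: "norm (\<phi> \<zeta>) < 1" if "norm \<zeta> < 1" for \<zeta>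
    unfolding \<phi>_def by (rule norm_Cayley_less_1[OF Repos[OF that] c(1)])
  have "norm (deriv \<phi> 0) \<le> 1"
    by (rule Schwarz_Lemma(2)[OF \<phi>_hol \<phi>0 \<phi>lt, where \<xi> = 0]) auto
  have ds: "(s has_field_derivative 2) (at 0)"
    unfolding s_def by (auto intro!: derivative_eq_intros)
  have "Q field_differentiable at 1"
    using hol by (rule holomorphic_on_imp_differentiable_at) (auto simp: complex_nonpos_Reals_iff)
  then have dQ: "(Q has_field_derivative deriv Q 1) (at (s 0 ^ 2))"
    by (simp add: s_def DERIV_deriv_iff_field_differentiable)
  have d2: "((\<lambda>\<zeta>. s \<zeta> ^ 2) has_field_derivative 4) (at 0)"
    by (rule derivative_eq_intros ds | simp add: s_def)+
  have d3: "((\<lambda>\<zeta>. Q (s \<zeta> ^ 2)) has_field_derivative deriv Q 1 * 4) (at 0)"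
    by (rule DERIV_chain2[OF dQ d2])
  have d4: "((\<lambda>\<zeta>. csqrt (Q (s \<zeta> ^ 2))) has_field_derivative
      inverse (2 * csqrt (Q (s 0 ^ 2))) * (deriv Q 1 * 4)) (at 0)"
    by (rule DERIV_chain2[OF has_field_derivative_csqrt d3]) (use Qs[of 0] in auto)
  then have d5: "((\<lambda>\<zeta>. csqrt (Q (s \<zeta> ^ 2))) has_field_derivative 2 * deriv Q 1 / of_real c) (at 0)"
    using c by (simp add: s_def cs field_simps)
  have d6: "(\<phi> has_field_derivative deriv Q 1 / of_real (c^2)) (at 0)"
  proof -
    define k where "k \<zeta> = csqrt (Q (s \<zeta> ^ 2))" for \<zeta>
    have k: "(k has_field_derivative 2 * deriv Q 1 / of_real c) (at 0)" "k 0 = of_real c"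
      using d5 by (simp_all add: k_def[abs_def] s_def cs)
    show ?thesis
      unfolding \<phi>_def k_def[symmetric] using c
      by (auto intro!: derivative_eq_intros k(1) simp: k(2) field_simps power2_eq_square)
  qed
  have "deriv \<phi> 0 = deriv Q 1 / of_real q" using DERIV_imp_deriv[OF d6] c(2) by simp
  then show ?thesis using \<open>norm (deriv \<phi> 0) \<le> 1\<close> q by (simp add: norm_divide)
qed


section \<open>Stable multiaffine polynomials and their positive weights\<close>

text \<open>The generating polynomial of the weights \<open>v\<close>.\<close>

definition multiaffine :: "'e set \<Rightarrow> ('e set \<Rightarrow> complex) \<Rightarrow> ('e \<Rightarrow> complex) \<Rightarrow> complex" where
  "multiaffine E v z = (\<Sum>U\<in>Pow E. v U * (\<Prod>e\<in>U. z e))"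

definition ma_stable :: "'e set \<Rightarrow> ('e set \<Rightarrow> complex) \<Rightarrow> bool" where
  "ma_stable E v \<longleftrightarrow> (\<forall>z. (\<forall>e\<in>E. Im (z e) > 0) \<longrightarrow> multiaffine E v z \<noteq> 0)"

lemma sum_Pow_insert:
  assumes "finite E" "e \<notin> E"
  shows "(\<Sum>U\<in>Pow (insert e E). g U) = (\<Sum>U\<in>Pow E. g U) + (\<Sum>U\<in>Pow E. g (insert e U))"
proof -
  have "inj_on (insert e) (Pow E)" using assms by (auto simp: inj_on_def)
  moreover have "Pow E \<inter> insert e ` Pow E = {}" using assms by auto
  ultimately show ?thesis
    unfolding Pow_insert using assms by (simp add: sum.union_disjoint sum.reindex)
qed

lemma multiaffine_insert:
  assumes "finite E" "e \<notin> E"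
  shows "multiaffine (insert e E) v z =
    multiaffine E v z + z e * multiaffine E (\<lambda>U. v (insert e U)) z"
proof -
  have "(\<Prod>x\<in>insert e U. z x) = z e * (\<Prod>x\<in>U. z x)" if "U \<in> Pow E" for U
  proof -
    have "finite U" "e \<notin> U" using that assms finite_subset by auto
    then show ?thesis by simp
  qed
  then show ?thesis
    unfolding multiaffine_def sum_Pow_insert[OF assms]
    by (simp add: sum_distrib_left algebra_simps)
qed

lemma multiaffine_cong:
  "(\<And>U. U \<subseteq> E \<Longrightarrow> v U = v' U) \<Longrightarrow> (\<And>e. e \<in> E \<Longrightarrow> z e = z' e) \<Longrightarrow>
    multiaffine E v z = multiaffine E v' z'"
  unfolding multiaffine_def by (intro sum.cong arg_cong2[where f = "(*)"] prod.cong) auto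

lemma multiaffine_lincomb:
  "multiaffine E (\<lambda>U. v U + c * v' U) z = multiaffine E v z + c * multiaffine E v' z"
  unfolding multiaffine_def by (simp add: sum.distrib sum_distrib_left algebra_simps)

lemma uniform_limit_finite_sum:
  fixes f :: "'i \<Rightarrow> 'n \<Rightarrow> 'a \<Rightarrow> complex"
  assumes "finite I" "\<And>i. i \<in> I \<Longrightarrow> uniform_limit K (f i) (g i) F"
  shows "uniform_limit K (\<lambda>n t. \<Sum>i\<in>I. f i n t) (\<lambda>t. \<Sum>i\<in>I. g i t) F"
  using assms by (induction I rule: finite_induct) (auto intro!: uniform_limit_intros)

text \<open>Hurwitz' theorem, applied on the complex line through the point \<open>1\<close> with all coordinates one and a
given point \<open>z\<close>. The part of that line inside the domain is convex and contains \<open>z\<close>. Nonvanishing at the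
real point \<open>1\<close>, which lies only on the boundary, excludes that the limit vanishes on the whole line.\<close>

lemma ma_stable_limit:
  assumes fin: "finite E"
    and lim: "\<And>U. U \<subseteq> E \<Longrightarrow> (\<lambda>n. v n U) \<longlonglongrightarrow> w U"
    and st: "\<And>n. ma_stable E (v n)"
    and one: "multiaffine E w (\<lambda>_. 1) \<noteq> 0"
  shows "ma_stable E w"
  unfolding ma_stable_def
proof (intro allI impI)
  fix z assume z: "\<forall>e\<in>E. Im (z e) > 0"
  define line where "line t e = 1 + t * (z e - 1)" for t e
  have line1: "line 1 = z" and line0: "line 0 = (\<lambda>_. 1)" by (auto simp: line_def)
  define D where "D = {t. \<forall>e\<in>E. Im (line t e) > 0}"
  have D_eq: "D = (\<Inter>e\<in>E. {t. Im (line t e) > 0})" by (auto simp: D_def)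
  have op: "open {t. Im (line t e) > 0}" for e
    unfolding line_def by (intro open_Collect_less continuous_intros)
  \<comment> \<open>The condition is real affine in \<open>t\<close>, that is, an open half plane.\<close>
  have cx: "convex {t. Im (line t e) > 0}" for e
  proof -
    have "{t. Im (line t e) > 0} = {t. inner (Complex (Im (z e - 1)) (Re (z e - 1))) t > 0}"
      by (auto simp: line_def inner_complex_def algebra_simps)
    then show ?thesis using convex_halfspace_gt by simp
  qed
  have D: "open D" "connected D" "1 \<in> D"
    using fin z by (auto simp: D_eq intro!: open_INT op convex_connected convex_INT cx)
                   (simp add: line1)
  have hol: "(\<lambda>t. multiaffine E u (line t)) holomorphic_on A" for u A
    unfolding multiaffine_def line_def by (intro holomorphic_intros)
  show "multiaffine E w z \<noteq> 0"
  proof (cases "(\<lambda>t. multiaffine E w (line t)) constant_on D")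
    case True
    show ?thesis
    proof
      assume "multiaffine E w z = 0"
      then have "multiaffine E w (line 1) = 0" by (simp add: line1)
      then have zero: "multiaffine E w (line t) = 0" if "t \<in> D" for t
        using True D(3) that unfolding constant_on_def by metis
      have "multiaffine E w (line 0) = 0"
      proof (rule analytic_continuation_open[where s = D and s' = UNIV and g = "\<lambda>_. 0"
            and f = "\<lambda>t. multiaffine E w (line t)"])
        show "(\<lambda>t. multiaffine E w (line t)) holomorphic_on UNIV" by (rule hol)
      qed (use D zero in auto)
      then show False using one by (simp add: line0)
    qed
  next
    case False
    have "multiaffine E w (line 1) \<noteq> 0"
    proof (rule Hurwitz_no_zeros[OF D(1,2) hol hol _ False _ D(3)])
      fix K assume K: "compact K" "K \<subseteq> D"
      have "uniform_limit K (\<lambda>n t. v n U * (\<Prod>e\<in>U. line t e)) (\<lambda>t. w U * (\<Prod>e\<in>U. line t e)) sequentially"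
        if "U \<subseteq> E" for U
      proof (rule uniform_lim_mult)
        show "uniform_limit K (\<lambda>n t. v n U) (\<lambda>t. w U) sequentially"
          using lim[OF that] unfolding uniform_limit_iff tendsto_iff by (auto elim: eventually_mono)
        show "uniform_limit K (\<lambda>n t. \<Prod>e\<in>U. line t e) (\<lambda>t. \<Prod>e\<in>U. line t e) sequentially"
          by (rule uniform_limit_const)
        have "continuous_on K (\<lambda>t. \<Prod>e\<in>U. line t e)"
          unfolding line_def by (intro continuous_intros)
        then show "bounded ((\<lambda>t. \<Prod>e\<in>U. line t e) ` K)"
          using K(1) compact_continuous_image compact_imp_bounded by blast
        show "bounded ((\<lambda>t. w U) ` K)" by (rule bounded_subset[of "{w U}"]) auto
      qed
      then show "uniform_limit K (\<lambda>n t. multiaffine E (v n) (line t)) (\<lambda>t. multiaffine E w (line t)) sequentially"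
        unfolding multiaffine_def using fin by (intro uniform_limit_finite_sum) auto
    next
      fix n t assume "t \<in> D"
      then show "multiaffine E (v n) (line t) \<noteq> 0"
        using st[of n] unfolding ma_stable_def D_def by blast
    qed
    then show ?thesis by (simp add: line1)
  qed
qed

text \<open>Strict positivity makes every conditional weight meaningful and keeps all conditionings nondegenerate.\<close>

definition positive_stable :: "'e set \<Rightarrow> ('e set \<Rightarrow> real) \<Rightarrow> bool" where
  "positive_stable E w \<longleftrightarrow> finite E \<and> (\<forall>U\<subseteq>E. w U > 0) \<and> ma_stable E (\<lambda>U. of_real (w U))"

lemma multiaffine_at_1_pos:
  assumes "finite E" "\<And>U. U \<subseteq> E \<Longrightarrow> (w U :: real) > 0"
  shows "multiaffine E (\<lambda>U. of_real (w U)) (\<lambda>_. 1) \<noteq> 0"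
proof -
  have "multiaffine E (\<lambda>U. of_real (w U)) (\<lambda>_. 1) = of_real (sum w (Pow E))"
    by (simp add: multiaffine_def)
  moreover have "sum w (Pow E) > 0" using assms by (intro sum_pos) auto
  ultimately show ?thesis by (metis less_irrefl of_real_eq_0_iff)
qed

lemma tendsto_i_div: "(\<lambda>n. \<i> / of_nat (Suc n)) \<longlonglongrightarrow> (0::complex)"
proof -
  have "(\<lambda>n. \<i> * of_real (inverse (real (Suc n)))) \<longlonglongrightarrow> \<i> * of_real 0"
    by (intro tendsto_intros LIMSEQ_inverse_real_of_nat)
  then show ?thesis by (simp add: field_simps)
qed

lemma Im_i_div: "Im (\<i> / of_nat (Suc n)) > 0"
  by (simp add: Im_divide_of_nat del: of_nat_Suc)

text \<open>The variable of \<open>e\<close> is set to the boundary point \<open>x\<close> by approaching it from the upper half plane. The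
cases \<open>x = 0\<close> and \<open>x = 1\<close> are conditioning on the absence of \<open>e\<close> and forgetting \<open>e\<close>.\<close>

lemma positive_stable_specialize:
  fixes x :: real
  assumes "positive_stable (insert e E) w" "e \<notin> E" "x \<ge> 0"
  shows "positive_stable E (\<lambda>U. w U + x * w (insert e U))"
proof -
  have fin: "finite E" using assms by (simp add: positive_stable_def)
  have pos: "w U + x * w (insert e U) > 0" if "U \<subseteq> E" for U
  proof -
    have "w U > 0" "w (insert e U) > 0"
      using assms(1) that Set.insert_mono[OF that] unfolding positive_stable_def by blast+
    then show ?thesis using assms(3) by (simp add: add_pos_nonneg)
  qed
  have "ma_stable E (\<lambda>U. of_real (w U + x * w (insert e U)))"
  proof (rule ma_stable_limit[OF fin])
    fix n
    let ?c = "of_real x + \<i> / of_nat (Suc n)"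
    show "ma_stable E (\<lambda>U. of_real (w U) + ?c * of_real (w (insert e U)))"
      unfolding ma_stable_def
    proof (intro allI impI)
      fix z assume z: "\<forall>e\<in>E. 0 < Im (z e)"
      let ?z = "z(e := ?c)"
      have "multiaffine (insert e E) (\<lambda>U. of_real (w U)) ?z \<noteq> 0"
        using assms(1) z Im_i_div[of n] unfolding positive_stable_def ma_stable_def by auto
      moreover have "multiaffine E u ?z = multiaffine E u z" for u
        using assms(2) by (intro multiaffine_cong) auto
      ultimately show "multiaffine E (\<lambda>U. of_real (w U) + ?c * of_real (w (insert e U))) z \<noteq> 0"
        unfolding multiaffine_insert[OF fin assms(2)] multiaffine_lincomb by simp
    qed
  next
    fix U
    have "(\<lambda>n. of_real (w U) + (of_real x + \<i> / of_nat (Suc n)) * of_real (w (insert e U)))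
      \<longlonglongrightarrow> of_real (w U) + (of_real x + 0) * complex_of_real (w (insert e U))"
      by (intro tendsto_intros tendsto_i_div)
    then show "(\<lambda>n. of_real (w U) + (of_real x + \<i> / of_nat (Suc n)) * of_real (w (insert e U)))
      \<longlonglongrightarrow> complex_of_real (w U + x * w (insert e U))" by simp
  qed (rule multiaffine_at_1_pos[OF fin pos])
  then show ?thesis using fin pos by (simp add: positive_stable_def)
qed

lemma positive_stable_delete: "positive_stable (insert e E) w \<Longrightarrow> e \<notin> E \<Longrightarrow> positive_stable E w"
  using positive_stable_specialize[of e E w 0] by simp

lemma positive_stable_sum_out: "positive_stable (insert e E) w \<Longrightarrow> e \<notin> E \<Longrightarrow> positive_stable E (\<lambda>U. w U + w (insert e U))"
  using positive_stable_specialize[of e E w 1] by simp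

text \<open>Conditioning on the presence of \<open>e\<close>: divide by the variable of \<open>e\<close> and let it tend to infinity along the
imaginary axis.\<close>

lemma positive_stable_contract:
  assumes "positive_stable (insert e E) w" "e \<notin> E"
  shows "positive_stable E (\<lambda>U. w (insert e U))"
proof -
  have fin: "finite E" using assms by (simp add: positive_stable_def)
  have pos: "w (insert e U) > 0" if "U \<subseteq> E" for U
    using assms(1) Set.insert_mono[OF that] unfolding positive_stable_def by blast
  have "ma_stable E (\<lambda>U. of_real (w (insert e U)))"
  proof (rule ma_stable_limit[OF fin])
    fix n
    \<comment> \<open>The reciprocal of the value \<open>\<i> * Suc n\<close> given to the variable of \<open>e\<close>.\<close>
    let ?c = "- (\<i> / of_nat (Suc n))"
    show "ma_stable E (\<lambda>U. of_real (w (insert e U)) + ?c * of_real (w U))"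
      unfolding ma_stable_def
    proof (intro allI impI)
      fix z assume z: "\<forall>e\<in>E. 0 < Im (z e)"
      let ?z = "z(e := \<i> * of_nat (Suc n))"
      have "multiaffine (insert e E) (\<lambda>U. of_real (w U)) ?z \<noteq> 0"
        using assms(1) z unfolding positive_stable_def ma_stable_def by auto
      moreover have "multiaffine E u ?z = multiaffine E u z" for u
        using assms(2) by (intro multiaffine_cong) auto
      ultimately have "multiaffine E (\<lambda>U. of_real (w U)) z
          + \<i> * of_nat (Suc n) * multiaffine E (\<lambda>U. of_real (w (insert e U))) z \<noteq> 0"
        unfolding multiaffine_insert[OF fin assms(2)] by simp
      moreover have "multiaffine E (\<lambda>U. of_real (w U)) z
          + \<i> * of_nat (Suc n) * multiaffine E (\<lambda>U. of_real (w (insert e U))) z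
          = \<i> * of_nat (Suc n) * (multiaffine E (\<lambda>U. of_real (w (insert e U))) z
             + ?c * multiaffine E (\<lambda>U. of_real (w U)) z)"
        by (simp add: field_simps del: of_nat_Suc)
      ultimately show "multiaffine E (\<lambda>U. of_real (w (insert e U)) + ?c * of_real (w U)) z \<noteq> 0"
        unfolding multiaffine_lincomb by simp
    qed
  next
    fix U
    have "(\<lambda>n. of_real (w (insert e U)) + - (\<i> / of_nat (Suc n)) * of_real (w U))
      \<longlonglongrightarrow> of_real (w (insert e U)) + - 0 * complex_of_real (w U)"
      by (intro tendsto_intros tendsto_i_div)
    then show "(\<lambda>n. of_real (w (insert e U)) + - (\<i> / of_nat (Suc n)) * of_real (w U))
      \<longlonglongrightarrow> complex_of_real (w (insert e U))" by simp
  qed (rule multiaffine_at_1_pos[OF fin pos])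
  then show ?thesis using fin pos by (simp add: positive_stable_def)
qed

lemma ma_stable_field:
  assumes "ma_stable E v" "r > 0"
  shows "ma_stable E (\<lambda>U. of_real r ^ card U * v U)"
proof -
  have "multiaffine E (\<lambda>U. of_real r ^ card U * v U) z = multiaffine E v (\<lambda>e. of_real r * z e)" for z
    unfolding multiaffine_def by (intro sum.cong) (auto simp: prod.distrib)
  then show ?thesis using assms unfolding ma_stable_def by simp
qed

lemma positive_stable_field:
  fixes r :: real
  assumes "positive_stable E w" "r > 0"
  shows "positive_stable E (\<lambda>U. r ^ card U * w U)"
  using assms ma_stable_field[of E "\<lambda>U. of_real (w U)" r] by (simp add: positive_stable_def)


section \<open>Covariances under weights on a power set\<close>

definition wsum :: "'e set \<Rightarrow> ('e set \<Rightarrow> real) \<Rightarrow> ('e set \<Rightarrow> real) \<Rightarrow> real" where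
  "wsum E w F = (\<Sum>U\<in>Pow E. w U * F U)"

text \<open>For weights of total mass \<open>Z\<close> this is \<open>Z\<^sup>2\<close> times the covariance, so no normalization is needed.\<close>

definition wcov :: "'e set \<Rightarrow> ('e set \<Rightarrow> real) \<Rightarrow> ('e set \<Rightarrow> real) \<Rightarrow> ('e set \<Rightarrow> real) \<Rightarrow> real" where
  "wcov E w F G = wsum E w (\<lambda>_. 1) * wsum E w (\<lambda>U. F U * G U) - wsum E w F * wsum E w G"

definition occ :: "'e \<Rightarrow> 'e set \<Rightarrow> real" where
  "occ e U = of_bool (e \<in> U)"

definition determined_by :: "'e set \<Rightarrow> ('e set \<Rightarrow> real) \<Rightarrow> bool" where
  "determined_by A F \<longleftrightarrow> (\<forall>U. F U = F (U \<inter> A))"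

lemma wsum_cong:
  "(\<And>U. U \<subseteq> E \<Longrightarrow> w U = w' U) \<Longrightarrow> (\<And>U. U \<subseteq> E \<Longrightarrow> F U = F' U) \<Longrightarrow> wsum E w F = wsum E w' F'"
  unfolding wsum_def by (intro sum.cong) auto

lemma wcov_cong:
  "(\<And>U. U \<subseteq> E \<Longrightarrow> F U = F' U) \<Longrightarrow> (\<And>U. U \<subseteq> E \<Longrightarrow> G U = G' U) \<Longrightarrow>
    wcov E w F G = wcov E w F' G'"
  unfolding wcov_def by (intro arg_cong2[where f = "(-)"] arg_cong2[where f = "(*)"] wsum_cong) auto

lemma wcov_commute: "wcov E w F G = wcov E w G F"
  unfolding wcov_def by (simp add: mult.commute)

lemma wsum_add: "wsum E w (\<lambda>U. F U + G U) = wsum E w F + wsum E w G"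
  unfolding wsum_def by (simp add: algebra_simps sum.distrib)

lemma wsum_cmult: "wsum E w (\<lambda>U. c * F U) = c * wsum E w F"
  unfolding wsum_def by (simp add: sum_distrib_left algebra_simps)

lemma wsum_const: "wsum E w (\<lambda>_. c) = c * wsum E w (\<lambda>_. 1)"
  using wsum_cmult[of E w c "\<lambda>_. 1"] by simp

lemma wcov_add_right: "wcov E w F (\<lambda>U. G U + H U) = wcov E w F G + wcov E w F H"
  unfolding wcov_def by (simp add: distrib_left wsum_add algebra_simps)

lemma wcov_cmult_right: "wcov E w F (\<lambda>U. c * G U) = c * wcov E w F G"
proof -
  have "(\<lambda>U. F U * (c * G U)) = (\<lambda>U. c * (F U * G U))" by (simp add: fun_eq_iff)
  then show ?thesis unfolding wcov_def by (simp add: wsum_cmult algebra_simps)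
qed

lemma wcov_const_left: "wcov E w (\<lambda>_. c) G = 0"
  unfolding wcov_def wsum_cmult wsum_const[of E w c] by simp

lemma wcov_const_right: "wcov E w F (\<lambda>_. c) = 0"
  by (simp add: wcov_commute[of E w F] wcov_const_left)

lemma wcov_sum_left:
  "finite I \<Longrightarrow> wcov E w (\<lambda>U. \<Sum>i\<in>I. F i U) G = (\<Sum>i\<in>I. wcov E w (F i) G)"
proof (induction I rule: finite_induct)
  case empty
  show ?case using wcov_const_left[of E w 0 G] by simp
next
  case (insert i I)
  then show ?case
    using wcov_add_right[of E w G "F i" "\<lambda>U. \<Sum>i\<in>I. F i U"] by (simp add: wcov_commute[of E w _ G])
qed

lemma wcov_double_sum:
  "wcov E w F G = (\<Sum>U\<in>Pow E. \<Sum>V\<in>Pow E. w U * w V * F U * (G U - G V))"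
proof -
  have "(\<Sum>U\<in>Pow E. \<Sum>V\<in>Pow E. w U * w V * F U * (G U - G V)) =
      (\<Sum>U\<in>Pow E. \<Sum>V\<in>Pow E. (w U * (F U * G U)) * w V) - (\<Sum>U\<in>Pow E. \<Sum>V\<in>Pow E. (w U * F U) * (w V * G V))"
    by (simp add: sum_subtractf[symmetric] algebra_simps)
  then show ?thesis
    unfolding wcov_def wsum_def sum_product[symmetric] by simp
qed

lemma wsum_insert:
  assumes "finite E" "e \<notin> E"
  shows "wsum (insert e E) w F = wsum E w F + wsum E (\<lambda>U. w (insert e U)) (\<lambda>U. F (insert e U))"
  unfolding wsum_def by (rule sum_Pow_insert[OF assms])

lemma wsum_occ:
  assumes "finite E" "e \<notin> E"
  shows "wsum (insert e E) w (\<lambda>U. occ e U * F U) = wsum E (\<lambda>U. w (insert e U)) (\<lambda>U. F (insert e U))"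
proof -
  have "wsum E w (\<lambda>U. occ e U * F U) = wsum E w (\<lambda>U. 0)"
    using assms(2) by (intro wsum_cong) (auto simp: occ_def)
  then show ?thesis unfolding wsum_insert[OF assms] by (simp add: wsum_def occ_def)
qed

lemma wcov_occ:
  assumes "finite E" "e \<notin> E"
  shows "wcov (insert e E) w (occ e) G =
    wsum E w (\<lambda>_. 1) * wsum E (\<lambda>U. w (insert e U)) (\<lambda>U. G (insert e U)) -
    wsum E (\<lambda>U. w (insert e U)) (\<lambda>_. 1) * wsum E w G"
proof -
  have S: "wsum (insert e E) w (occ e) = wsum E (\<lambda>U. w (insert e U)) (\<lambda>_. 1)"
    using wsum_occ[OF assms, of w "\<lambda>_. 1"] by simp
  show ?thesis
    unfolding wcov_def wsum_occ[OF assms] S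
    unfolding wsum_insert[OF assms] by (simp add: algebra_simps)
qed

text \<open>The law of total covariance for conditioning on \<open>e\<close>. Since
\<open>wcov (insert e E) w (occ e) F\<close> is, up to a positive factor, the difference of the conditional means of
\<open>F\<close>, the last summand is the covariance between the conditional means.\<close>

lemma wcov_decomposition:
  fixes w :: "'e set \<Rightarrow> real"
  assumes fin: "finite E" and e: "e \<notin> E"
  defines "w1 \<equiv> \<lambda>U. w (insert e U)"
  assumes Z0: "wsum E w (\<lambda>_. 1) > 0" and Z1: "wsum E w1 (\<lambda>_. 1) > 0"
  shows "wcov (insert e E) w F G =
    wsum (insert e E) w (\<lambda>_. 1) *
      (wcov E w F G / wsum E w (\<lambda>_. 1) +
       wcov E w1 (\<lambda>U. F (insert e U)) (\<lambda>U. G (insert e U)) / wsum E w1 (\<lambda>_. 1)) +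
    wcov (insert e E) w (occ e) F * wcov (insert e E) w (occ e) G /
      (wsum E w (\<lambda>_. 1) * wsum E w1 (\<lambda>_. 1))"
  using Z0 Z1 unfolding wcov_occ[OF fin e] w1_def[symmetric]
  by (simp add: wcov_def wsum_insert[OF fin e] w1_def[symmetric] field_simps)

lemma wsum_1_pos:
  assumes "positive_stable E w" shows "wsum E w (\<lambda>_. 1) > 0"
  unfolding wsum_def using assms by (auto simp: positive_stable_def intro!: sum_pos)

lemma determined_byD:
  "determined_by A F \<Longrightarrow> U \<inter> A = V \<inter> A \<Longrightarrow> F U = F V"
  unfolding determined_by_def by metis

text \<open>Elements outside \<open>A\<close> are forgotten one at a time.\<close>

lemma positive_stable_marginal:
  assumes "positive_stable E w" "A \<subseteq> E"
  obtains w' where "positive_stable A w'" "\<And>F. determined_by A F \<Longrightarrow> wsum E w F = wsum A w' F"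
proof -
  have "\<exists>w'. positive_stable A w' \<and> (\<forall>F. determined_by A F \<longrightarrow> wsum (A \<union> D) w F = wsum A w' F)"
    if "finite D" "A \<inter> D = {}" "positive_stable (A \<union> D) w" for D w
    using that
  proof (induction D arbitrary: w rule: finite_induct)
    case empty
    then show ?case by auto
  next
    case (insert d D)
    have d: "d \<notin> A \<union> D" using insert by auto
    have SRi: "positive_stable (insert d (A \<union> D)) w" using insert.prems by simp
    then have fin: "finite (A \<union> D)" by (simp add: positive_stable_def)
    obtain w' where w': "positive_stable A w'"
      "\<And>F. determined_by A F \<Longrightarrow> wsum (A \<union> D) (\<lambda>U. w U + w (insert d U)) F = wsum A w' F"
      using insert.IH[OF _ positive_stable_sum_out[OF SRi d]] insert.prems by auto
    have "wsum (A \<union> insert d D) w F = wsum A w' F" if F: "determined_by A F" for F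
    proof -
      have "F (insert d U) = F U" for U using d by (intro determined_byD[OF F]) auto
      then have "wsum (insert d (A \<union> D)) w F = wsum (A \<union> D) (\<lambda>U. w U + w (insert d U)) F"
        unfolding wsum_insert[OF fin d] by (simp add: wsum_def sum.distrib algebra_simps)
      then show ?thesis using w'(2)[OF F] by simp
    qed
    then show ?case using w'(1) by blast
  qed
  from this[of "E - A" w] assms that show ?thesis
    by (auto simp: positive_stable_def Un_absorb1)
qed

lemma positive_stable_marginal_wcov:
  assumes "positive_stable E w" "A \<subseteq> E"
  obtains w' where "positive_stable A w'"
    "\<And>F G. determined_by A F \<Longrightarrow> determined_by A G \<Longrightarrow> wcov E w F G = wcov A w' F G"
proof -
  obtain w' where w': "positive_stable A w'" "\<And>F. determined_by A F \<Longrightarrow> wsum E w F = wsum A w' F"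
    using positive_stable_marginal[OF assms] by blast
  have "wcov E w F G = wcov A w' F G" if "determined_by A F" "determined_by A G" for F G
  proof -
    have "determined_by A (\<lambda>_. 1)" "determined_by A (\<lambda>U. F U * G U)"
      using that unfolding determined_by_def by metis+
    then show ?thesis unfolding wcov_def using that w'(2) by simp
  qed
  then show ?thesis using that w'(1) by blast
qed

lemma determined_by_occ: "e \<in> A \<Longrightarrow> determined_by A (occ e)"
  by (simp add: determined_by_def occ_def)

text \<open>After passing to the marginal on \<open>{e, f}\<close> the polynomial is \<open>\<alpha> + \<beta> z\<^sub>e + \<gamma> z\<^sub>f + \<delta> z\<^sub>e z\<^sub>f\<close> and the
covariance is \<open>\<alpha> \<delta> - \<beta> \<gamma>\<close>. If this were positive, solving for \<open>z\<^sub>f\<close> would be a Moebius map of positive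
determinant in \<open>z\<^sub>e\<close>, hence would give a zero with both variables in the upper half plane.\<close>

lemma wcov_occ_occ_nonpos:
  assumes "positive_stable E w" "e \<in> E" "f \<in> E" "e \<noteq> f"
  shows "wcov E w (occ e) (occ f) \<le> 0"
proof -
  obtain w' where w': "positive_stable {e, f} w'"
    "\<And>F G. determined_by {e, f} F \<Longrightarrow> determined_by {e, f} G \<Longrightarrow> wcov E w F G = wcov {e, f} w' F G"
    using positive_stable_marginal_wcov[OF assms(1), of "{e, f}"] assms by auto
  define \<alpha> \<beta> \<gamma> \<delta> where abcd: "\<alpha> = w' {}" "\<beta> = w' {e}" "\<gamma> = w' {f}" "\<delta> = w' {e, f}"
  have pos: "\<alpha> > 0" "\<beta> > 0" "\<gamma> > 0" "\<delta> > 0" using w'(1) by (auto simp: positive_stable_def abcd)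
  have poly: "multiaffine {e, f} (\<lambda>U. of_real (w' U)) z = of_real \<alpha> + of_real \<gamma> * z f + z e * (of_real \<beta> + of_real \<delta> * z f)"
    for z
    using assms(4) by (simp add: multiaffine_insert) (simp add: multiaffine_def abcd)
  have "\<alpha> * \<delta> \<le> \<beta> * \<gamma>"
  proof (rule ccontr)
    assume neg: "\<not> \<alpha> * \<delta> \<le> \<beta> * \<gamma>"
    define \<zeta> where "\<zeta> = - (of_real \<alpha> + of_real \<beta> * \<i>) / (of_real \<gamma> + of_real \<delta> * \<i>)"
    have nz: "of_real \<gamma> + of_real \<delta> * \<i> \<noteq> 0" using pos by (auto simp: complex_eq_iff)
    have "Im \<zeta> = (\<alpha> * \<delta> - \<beta> * \<gamma>) / (\<gamma>^2 + \<delta>^2)"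
      unfolding \<zeta>_def Im_divide by (simp add: field_simps)
    moreover have "\<gamma>^2 + \<delta>^2 > 0" using pos by (simp add: sum_power2_gt_zero_iff)
    ultimately have Im: "Im \<zeta> > 0" using neg by simp
    define z where "z = (\<lambda>x. if x = e then \<i> else \<zeta>)"
    have "\<zeta> * (of_real \<gamma> + of_real \<delta> * \<i>) = - (of_real \<alpha> + of_real \<beta> * \<i>)"
      using nz by (simp add: \<zeta>_def)
    then have "multiaffine {e, f} (\<lambda>U. of_real (w' U)) z = 0"
      unfolding poly using assms(4) by (simp add: z_def algebra_simps)
    moreover have "\<forall>x\<in>{e, f}. Im (z x) > 0" using Im by (simp add: z_def)
    ultimately show False using w'(1) unfolding positive_stable_def ma_stable_def by blast
  qed
  moreover have "wcov {e, f} w' (occ e) (occ f) = \<alpha> * \<delta> - \<beta> * \<gamma>"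
    using assms(4) by (simp add: wcov_occ wsum_insert) (simp add: wsum_def occ_def abcd algebra_simps)
  ultimately show ?thesis using w'(2)[of "occ e" "occ f"] by (simp add: determined_by_occ)
qed


section \<open>Negative association for positive stable weights\<close>

text \<open>On the diagonal the generating polynomial is \<open>a(t) + z b(t)\<close>, and the claim unfolds to
\<open>a' b - a b' \<le> a b\<close> at \<open>t = 1\<close>, that is, \<open>R' \<le> R\<close> for \<open>R = a / b\<close>. Stability says that \<open>R\<close> maps the
upper half plane to its closure, and positive coefficients give \<open>R > 0\<close> on the positive axis.
Adding \<open>t\<close> changes both sides of the claim equally and moves the image into the open slit plane.\<close>

lemma wcov_occ_card_nonneg:
  assumes positive_stable: "positive_stable (insert e E) w" and e: "e \<notin> E"
  shows "wcov (insert e E) w (occ e) (\<lambda>U. real (card U)) \<ge> 0"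
proof -
  have fin: "finite E" using positive_stable by (simp add: positive_stable_def)
  define w1 where "w1 = (\<lambda>U. w (insert e U))"
  have SR0: "positive_stable E w" and SR1: "positive_stable E w1" unfolding w1_def using positive_stable_delete[OF positive_stable e] positive_stable_contract[OF positive_stable e] .
  define p where "p u t = (\<Sum>U\<in>Pow E. of_real (u U) * t ^ card U)" for u and t :: complex
  have p_ma: "multiaffine E (\<lambda>U. of_real (u U)) z = p u t" if "\<And>x. x \<in> E \<Longrightarrow> z x = t" for u z t
  proof -
    have "(\<Prod>x\<in>U. z x) = t ^ card U" if "U \<in> Pow E" for U
      using that \<open>\<And>x. x \<in> E \<Longrightarrow> z x = t\<close> by (subst prod.cong[of U U z "\<lambda>_. t"]) auto
    then show ?thesis unfolding multiaffine_def p_def by simp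
  qed
  have p_nz: "p w1 t \<noteq> 0" if "Im t > 0" for t
    using SR1 that p_ma[of "\<lambda>_. t" t w1] unfolding positive_stable_def ma_stable_def by auto
  have pair: "p w t + z * p w1 t \<noteq> 0" if "Im t > 0" "Im z > 0" for t z
  proof -
    let ?z = "(\<lambda>_. t)(e := z)"
    have "multiaffine (insert e E) (\<lambda>U. of_real (w U)) ?z \<noteq> 0"
      using positive_stable that unfolding positive_stable_def ma_stable_def by simp
    moreover have "p w t = multiaffine E (\<lambda>U. of_real (w U)) ?z"
      "p w1 t = multiaffine E (\<lambda>U. of_real (w1 U)) ?z"
      using e by (intro p_ma[symmetric]; force)+
    ultimately show ?thesis
      unfolding multiaffine_insert[OF fin e] w1_def by simp
  qed
  define Q where "Q t = p w t / p w1 t + t" for t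
  have p_cnj: "p u (cnj t) = cnj (p u t)" for u t by (simp add: p_def)
  have Q_cnj: "Q (cnj t) = cnj (Q t)" for t by (simp add: Q_def p_cnj)
  have Im_pos: "Im (Q t) > 0" if "Im t > 0" for t
  proof -
    have "p w t + (- (p w t / p w1 t)) * p w1 t = 0" using p_nz[OF that] by simp
    then have "\<not> Im (- (p w t / p w1 t)) > 0" using pair[OF that] by blast
    then show ?thesis using that by (simp add: Q_def)
  qed
  have p_real: "\<exists>y>0. p u (of_real x) = of_real y" if "x > 0" "positive_stable E u" for x u
  proof (intro exI conjI)
    show "0 < (\<Sum>U\<in>Pow E. u U * x ^ card U)"
      using that fin by (intro sum_pos) (auto simp: positive_stable_def)
  qed (simp add: p_def)
  have slit: "Im t > 0 \<or> Im (cnj t) > 0 \<or> (\<exists>x>0. t = of_real x)" if "t \<notin> \<real>\<^sub>\<le>\<^sub>0" for t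
    using that complex_is_Real_iff[of t]
    by (cases "Im t = 0") (auto simp: complex_nonpos_Reals_iff complex_eq_iff intro!: exI[of _ "Re t"])
  have p_nz': "p w1 t \<noteq> 0" if "t \<notin> \<real>\<^sub>\<le>\<^sub>0" for t
    using slit[OF that]
  proof (elim disjE exE conjE)
    assume "Im (cnj t) > 0"
    then show ?thesis using p_nz[of "cnj t"] by (simp add: p_cnj)
  qed (use p_nz p_real[OF _ SR1] in force)+
  have "Q holomorphic_on - \<real>\<^sub>\<le>\<^sub>0"
    unfolding Q_def p_def using p_nz' by (intro holomorphic_intros) (auto simp: p_def)
  moreover have "Q t \<notin> \<real>\<^sub>\<le>\<^sub>0" if "t \<notin> \<real>\<^sub>\<le>\<^sub>0" for t
    using slit[OF that]
  proof (elim disjE exE conjE)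
    assume "Im t > 0"
    then show ?thesis using Im_pos[of t] by (auto simp: complex_nonpos_Reals_iff)
  next
    assume "Im (cnj t) > 0"
    then show ?thesis using Im_pos[of "cnj t"] by (auto simp: complex_nonpos_Reals_iff Q_cnj)
  next
    fix x assume x: "x > 0" "t = of_real x"
    obtain y y' where "y > 0" "y' > 0" "p w t = of_real y" "p w1 t = of_real y'"
      using p_real[OF x(1) SR0] p_real[OF x(1) SR1] x(2) by auto
    then have "Re (Q t) > 0" using x by (simp add: Q_def Re_divide_of_real add_pos_pos)
    then show ?thesis by (auto simp: complex_nonpos_Reals_iff)
  qed
  moreover
  define a a' b b' where ab: "a = wsum E w (\<lambda>_. 1)" "a' = wsum E w (\<lambda>U. real (card U))"
    "b = wsum E w1 (\<lambda>_. 1)" "b' = wsum E w1 (\<lambda>U. real (card U))"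
  have pos: "a > 0" "b > 0" unfolding ab using wsum_1_pos SR0 SR1 by auto
  have p1: "p w 1 = of_real a" "p w1 1 = of_real b" by (simp_all add: p_def ab wsum_def)
  then have "Q 1 = of_real (a / b + 1)" by (simp add: Q_def)
  moreover have "a / b + 1 > 0" using pos by (simp add: add_pos_pos)
  ultimately have bound: "norm (deriv Q 1) \<le> a / b + 1" by (rule Schwarz_Pick_slit_plane)
  have dp: "(p u has_field_derivative of_real (wsum E u (\<lambda>U. real (card U)))) (at 1)" for u
    unfolding p_def wsum_def by (auto intro!: derivative_eq_intros sum.cong)
  have "(Q has_field_derivative of_real ((a' * b - a * b') / b\<^sup>2 + 1)) (at 1)"
    unfolding Q_def using pos
    by (auto intro!: derivative_eq_intros dp simp: p1 ab[symmetric] power2_eq_square)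
  then have "deriv Q 1 = of_real ((a' * b - a * b') / b\<^sup>2 + 1)" by (rule DERIV_imp_deriv)
  then have "(a' * b - a * b') / b\<^sup>2 + 1 \<le> a / b + 1"
    using bound by (simp only: norm_of_real abs_le_iff)
  then have "(a' * b - a * b') / b\<^sup>2 \<le> (a * b) / b\<^sup>2" using pos by (simp add: power2_eq_square)
  then have *: "a' * b - a * b' \<le> a * b" using pos by (simp add: divide_le_cancel)
  have "wsum E w1 (\<lambda>U. real (card (insert e U))) = wsum E w1 (\<lambda>U. real (card U) + 1)"
  proof (rule wsum_cong)
    fix U assume "U \<subseteq> E"
    then have "finite U" "e \<notin> U" using fin e finite_subset by auto
    then show "real (card (insert e U)) = real (card U) + 1" by simp
  qed simp
  then have "wcov (insert e E) w (occ e) (\<lambda>U. real (card U)) = a * (b' + b) - b * a'"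
    unfolding wcov_occ[OF fin e] w1_def[symmetric] by (simp add: wsum_add ab)
  then show ?thesis using * by (simp add: algebra_simps)
qed

lemma card_eq_sum_occ: "finite E \<Longrightarrow> U \<subseteq> E \<Longrightarrow> real (card U) = (\<Sum>e\<in>E. occ e U)"
  by (simp add: occ_def of_bool_def sum.If_cases Int_absorb1 Int_absorb2)

lemma wcov_card_eq_sum:
  assumes "finite E"
  shows "wcov E w (\<lambda>U. real (card U)) F = (\<Sum>e\<in>E. wcov E w (occ e) F)"
  unfolding wcov_sum_left[OF assms, symmetric]
  by (rule wcov_cong) (simp_all add: card_eq_sum_occ[OF assms])

text \<open>Under the external field \<open>r\<close> the covariance with the cardinality is a polynomial in \<open>r\<close> without constant
term; the statement splits off one factor \<open>r\<close>.\<close>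

lemma wcov_card_field:
  fixes F :: "'e set \<Rightarrow> real" and w :: "'e set \<Rightarrow> real"
  defines "h \<equiv> \<lambda>E r. \<Sum>(U, V)\<in>Pow E \<times> Pow E.
      r ^ (card U - 1 + card V) * (w U * w V * real (card U) * (F U - F V))"
  shows "wcov E (\<lambda>U. r ^ card U * w U) (\<lambda>U. real (card U)) F = r * h E r"
proof -
  have "r ^ card U * w U * (r ^ card V * w V) * real (card U) * (F U - F V) =
    r * (r ^ (card U - 1 + card V) * (w U * w V * real (card U) * (F U - F V)))" for U V
    by (cases "card U") (simp_all add: power_add)
  then show ?thesis
    unfolding wcov_double_sum h_def sum.cartesian_product sum_distrib_left
    by (intro sum.cong) auto
qed

text \<open>Strictness of the monotonicity is what makes the induction work: a zero of the covariance along the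
external field is excluded because both conditional covariances are strictly positive by induction.\<close>

lemma wcov_card_strict_pos:
  assumes "positive_stable E w" "E \<noteq> {}" "\<And>U V. V \<subseteq> E \<Longrightarrow> U \<subset> V \<Longrightarrow> F U < F V"
  shows "wcov E w (\<lambda>U. real (card U)) F > 0"
  using assms
proof (induction "card E" arbitrary: E w F rule: less_induct)
  case less
  have fin: "finite E" using less.prems(1) by (simp add: positive_stable_def)
  let ?N = "\<lambda>U. real (card U)"
  define h where "h r = (\<Sum>(U, V)\<in>Pow E \<times> Pow E.
      r ^ (card U - 1 + card V) * (w U * w V * real (card U) * (F U - F V)))" for r
  have psi: "wcov E (\<lambda>U. r ^ card U * w U) ?N F = r * h r" for r
    unfolding h_def by (rule wcov_card_field)
  \<comment> \<open>A zero at \<open>r\<close> is contradicted by conditioning, under the field \<open>r\<close>, on a suitable element.\<close>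
  have nonzero: "h r \<noteq> 0" if "r > 0" for r
  proof
    assume "h r = 0"
    define v where "v = (\<lambda>U. r ^ card U * w U)"
    have SRv: "positive_stable E v" unfolding v_def using positive_stable_field less.prems(1) that by blast
    have zero: "wcov E v ?N F = 0" using psi[of r] \<open>h r = 0\<close> by (simp add: v_def)
    then have "\<exists>e\<in>E. wcov E v (occ e) F \<ge> 0"
      unfolding wcov_card_eq_sum[OF fin] using less.prems(2) fin
      by (metis sum_strict_mono[of E "\<lambda>e. wcov E v (occ e) F" "\<lambda>_. 0"] sum.neutral_const not_less less_irrefl)
    then obtain e where e: "e \<in> E" "wcov E v (occ e) F \<ge> 0" by blast
    define E' where "E' = E - {e}"
    have E: "E = insert e E'" "e \<notin> E'" "finite E'" using e fin by (auto simp: E'_def)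
    define v1 where "v1 = (\<lambda>U. v (insert e U))"
    define F1 where "F1 = (\<lambda>U. F (insert e U))"
    have SR0: "positive_stable E' v" and SR1: "positive_stable E' v1"
      unfolding v1_def using positive_stable_delete positive_stable_contract SRv E by metis+
    have Z: "wsum E' v (\<lambda>_. 1) > 0" "wsum E' v1 (\<lambda>_. 1) > 0" "wsum E v (\<lambda>_. 1) > 0"
      using wsum_1_pos SR0 SR1 SRv by blast+
    have shift: "wcov E' v1 (\<lambda>U. real (card (insert e U))) F1 = wcov E' v1 ?N F1"
    proof -
      have "wcov E' v1 (\<lambda>U. real (card (insert e U))) F1 = wcov E' v1 (\<lambda>U. ?N U + 1) F1"
      proof (rule wcov_cong)
        fix U assume "U \<subseteq> E'"
        then have "finite U" "e \<notin> U" using E finite_subset by auto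
        then show "real (card (insert e U)) = ?N U + 1" by simp
      qed simp
      then show ?thesis by (simp add: wcov_commute[of _ _ _ F1] wcov_add_right wcov_const_right)
    qed
    have decomp: "wcov E v ?N F =
        wsum E v (\<lambda>_. 1) * (wcov E' v ?N F / wsum E' v (\<lambda>_. 1) + wcov E' v1 ?N F1 / wsum E' v1 (\<lambda>_. 1)) +
        wcov E v (occ e) ?N * wcov E v (occ e) F / (wsum E' v (\<lambda>_. 1) * wsum E' v1 (\<lambda>_. 1))"
      using wcov_decomposition[OF E(3,2), of v ?N F] Z(1,2)
      unfolding shift[unfolded v1_def F1_def, symmetric] v1_def F1_def E(1)[symmetric] by simp
    show False
    proof (cases "E' = {}")
      case True
      have "wcov E v ?N F = v {} * v {e} * (F {e} - F {})"
        unfolding E(1) True wcov_double_sum by (simp add: Pow_insert)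
      moreover have "v {} > 0" "v {e} > 0" using SRv unfolding positive_stable_def E(1) by auto
      moreover have "F {e} - F {} > 0" using less.prems(3)[of "{e}" "{}"] e(1) by auto
      ultimately show False using zero by simp
    next
      case False
      have "card E' < card E" unfolding E'_def by (rule card_Diff1_less[OF fin e(1)])
      have pos0: "wcov E' v ?N F > 0"
        using less.hyps[OF \<open>card E' < card E\<close> SR0 False, of F] less.prems(3) E(1) by blast
      have pos1: "wcov E' v1 ?N F1 > 0"
      proof (rule less.hyps[OF \<open>card E' < card E\<close> SR1 False])
        fix U V assume UV: "V \<subseteq> E'" "U \<subset> V"
        have "insert e U \<subset> insert e V" using UV E(2) by auto
        moreover have "insert e V \<subseteq> E" using UV E(1) by auto
        ultimately show "F1 U < F1 V" unfolding F1_def using less.prems(3) by blast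
      qed
      have "wcov E v (occ e) ?N \<ge> 0" using wcov_occ_card_nonneg[OF SRv[unfolded E(1)] E(2)] E(1) by simp
      then have "wcov E v (occ e) ?N * wcov E v (occ e) F / (wsum E' v (\<lambda>_. 1) * wsum E' v1 (\<lambda>_. 1)) \<ge> 0"
        using e(2) Z by simp
      moreover have "wsum E v (\<lambda>_. 1) * (wcov E' v ?N F / wsum E' v (\<lambda>_. 1) + wcov E' v1 ?N F1 / wsum E' v1 (\<lambda>_. 1)) > 0"
        using pos0 pos1 Z by (intro mult_pos_pos add_pos_pos divide_pos_pos)
      ultimately show False using zero decomp by simp
    qed
  qed
  \<comment> \<open>At \<open>r = 0\<close> only singletons \<open>U\<close> and empty \<open>V\<close> contribute.\<close>
  have "h 0 > 0"
  proof -
    obtain e where e: "e \<in> E" using less.prems(2) by blast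
    have wpos: "w U > 0" if "U \<subseteq> E" for U using less.prems(1) that by (simp add: positive_stable_def)
    show ?thesis unfolding h_def
    proof (rule sum_pos2[where i = "({e}, {})"])
      show "finite (Pow E \<times> Pow E)" using fin by simp
      show "({e}, {}) \<in> Pow E \<times> Pow E" using e by simp
      show "0 < (case ({e}, {}) of (U, V) \<Rightarrow>
          0 ^ (card U - 1 + card V) * (w U * w V * real (card U) * (F U - F V)))"
        using wpos[of "{e}"] wpos[of "{}"] less.prems(3)[of "{e}" "{}"] e by (auto simp: psubset_eq)
    next
      fix q assume "q \<in> Pow E \<times> Pow E"
      then obtain U V where q: "q = (U, V)" "U \<subseteq> E" "V \<subseteq> E" by auto
      have "0 \<le> 0 ^ (card U - 1 + card V) * (w U * w V * real (card U) * (F U - F V))"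
      proof (cases "card U - 1 + card V = 0 \<and> U \<noteq> {}")
        case True
        moreover have "finite V" using q(3) fin finite_subset by blast
        ultimately have "V = {}" by simp
        then have "F U - F V > 0" using True less.prems(3)[of U "{}"] q by auto
        then show ?thesis using wpos q by (simp add: less_imp_le)
      next
        case False
        then show ?thesis by (cases "U = {}") (auto simp: power_0_left)
      qed
      then show "0 \<le> (case q of (U, V) \<Rightarrow>
          0 ^ (card U - 1 + card V) * (w U * w V * real (card U) * (F U - F V)))" by (simp add: q)
    qed
  qed
  have cont: "continuous_on {0..1} h"
    unfolding h_def case_prod_beta by (intro continuous_intros)
  have "h 1 > 0"
  proof (intro not_le_imp_less notI)
    assume "h 1 \<le> 0"
    then obtain x where x: "0 \<le> x" "h x = 0"
      using IVT2'[of h 1 0 0] \<open>h 0 > 0\<close> cont by auto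
    then show False using nonzero[of x] \<open>h 0 > 0\<close> by (cases "x = 0") auto
  qed
  then show ?case using psi[of 1] by simp
qed

text \<open>The cardinality is the sum of the indicators, so it suffices that it does not correlate negatively
with \<open>F\<close>. Perturbing \<open>F\<close> by a small multiple of the cardinality makes it strictly increasing.\<close>

lemma exists_occ_wcov_nonneg:
  assumes "positive_stable E w" "E \<noteq> {}" "mono F"
  obtains e where "e \<in> E" "wcov E w (occ e) F \<ge> 0"
proof (rule ccontr)
  assume "\<not> thesis"
  then have neg: "\<And>e. e \<in> E \<Longrightarrow> wcov E w (occ e) F < 0" using that not_less by blast
  have fin: "finite E" using assms(1) by (simp add: positive_stable_def)
  let ?N = "\<lambda>U. real (card U)"
  have "wcov E w ?N F < 0"
    unfolding wcov_card_eq_sum[OF fin]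
    using sum_strict_mono[of E "\<lambda>e. wcov E w (occ e) F" "\<lambda>_. 0"] fin assms(2) neg by simp
  moreover have perturbed: "wcov E w ?N F + r * wcov E w ?N ?N > 0" if "r > 0" for r
  proof -
    have "wcov E w ?N (\<lambda>U. F U + r * real (card U)) > 0"
    proof (rule wcov_card_strict_pos[OF assms(1,2)])
      fix U V assume UV: "V \<subseteq> E" "U \<subset> V"
      then have "card U < card V" using fin finite_subset psubset_card_mono by blast
      then have "r * real (card U) < r * real (card V)" using that by simp
      moreover have "F U \<le> F V" using UV assms(3) by (simp add: monoD)
      ultimately show "F U + r * real (card U) < F V + r * real (card V)" by linarith
    qed
    then show ?thesis by (simp add: wcov_add_right wcov_cmult_right)
  qed
  ultimately have c: "wcov E w ?N ?N > 0" using perturbed[of 1] by simp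
  show False
    using perturbed[of "- wcov E w ?N F / wcov E w ?N ?N"] \<open>wcov E w ?N F < 0\<close> c by (simp add: divide_neg_pos)
qed

text \<open>The induction of Feder and Mihail. Condition on an \<open>f\<close> on which \<open>F\<close> depends and with which \<open>F\<close> correlates
nonnegatively: the conditional covariances are nonpositive by induction, and the covariance of the
conditional means is a product of factors of opposite sign. The hypothesis on \<open>G\<close> quantifies over all
weights so that it survives the conditioning.\<close>

lemma wcov_nonpos_induct:
  assumes occ_neg: "\<And>E w f. positive_stable E w \<Longrightarrow> B \<subseteq> E \<Longrightarrow> f \<in> E - B \<Longrightarrow> wcov E w (occ f) G \<le> 0"
    and G: "determined_by B G"
  shows "positive_stable E w \<Longrightarrow> A \<subseteq> E \<Longrightarrow> B \<subseteq> E \<Longrightarrow> A \<inter> B = {} \<Longrightarrow> mono F \<Longrightarrow> determined_by A F \<Longrightarrow>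
    wcov E w F G \<le> 0"
proof (induction "card A" arbitrary: A E w F)
  case 0
  moreover have "finite A" using 0(2,3) finite_subset by (auto simp: positive_stable_def)
  ultimately have "A = {}" by simp
  then have "wcov E w F G = wcov E w (\<lambda>_. F {}) G"
    using determined_byD[OF 0(7)] by (intro wcov_cong) auto
  then show ?case by (simp add: wcov_const_left)
next
  case (Suc n)
  obtain w' where w': "positive_stable A w'"
    "\<And>F G. determined_by A F \<Longrightarrow> determined_by A G \<Longrightarrow> wcov E w F G = wcov A w' F G"
    using positive_stable_marginal_wcov[OF Suc.prems(1,2)] by blast
  have "A \<noteq> {}" using Suc.hyps(2) by auto
  then obtain f where f: "f \<in> A" "wcov A w' (occ f) F \<ge> 0"
    using exists_occ_wcov_nonneg[OF w'(1) _ Suc.prems(5)] by blast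
  then have fF: "wcov E w (occ f) F \<ge> 0"
    using w'(2)[OF determined_by_occ[OF f(1)] Suc.prems(6)] by simp
  have fG: "wcov E w (occ f) G \<le> 0" using occ_neg Suc.prems f(1) by blast
  define E' A' where EA: "E' = E - {f}" "A' = A - {f}"
  have E: "E = insert f E'" "f \<notin> E'" "finite E'"
    using f(1) Suc.prems(1,2) by (auto simp: EA positive_stable_def)
  have A': "n = card A'" "A' \<subseteq> E'" "B \<subseteq> E'" "A' \<inter> B = {}"
    using Suc.hyps(2) Suc.prems f(1) by (auto simp: EA)
  define w1 where "w1 = (\<lambda>U. w (insert f U))"
  have SR0: "positive_stable E' w" and SR1: "positive_stable E' w1"
    unfolding w1_def using positive_stable_delete positive_stable_contract Suc.prems(1) E by metis+
  have Z: "wsum E' w (\<lambda>_. 1) > 0" "wsum E' w1 (\<lambda>_. 1) > 0" "wsum E w (\<lambda>_. 1) > 0"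
    using wsum_1_pos SR0 SR1 Suc.prems(1) by blast+
  have G1: "G (insert f U) = G U" for U
    using f(1) Suc.prems(4) by (intro determined_byD[OF G]) auto
  have "wcov E' w (\<lambda>U. F (U - {f})) G \<le> 0"
  proof (rule Suc.hyps(1)[OF A'(1) SR0 A'(2-4)])
    show "mono (\<lambda>U. F (U - {f}))" by (intro monoI monoD[OF Suc.prems(5)]) auto
    show "determined_by A' (\<lambda>U. F (U - {f}))"
      unfolding determined_by_def EA by (auto intro!: determined_byD[OF Suc.prems(6)])
  qed
  moreover have "wcov E' w (\<lambda>U. F (U - {f})) G = wcov E' w F G"
    using E(2) by (intro wcov_cong) (auto intro!: arg_cong[where f = F])
  ultimately have K0: "wcov E' w F G \<le> 0" by simp
  have K1: "wcov E' w1 (\<lambda>U. F (insert f U)) G \<le> 0"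
  proof (rule Suc.hyps(1)[OF A'(1) SR1 A'(2-4)])
    show "mono (\<lambda>U. F (insert f U))" by (intro monoI monoD[OF Suc.prems(5)]) auto
    show "determined_by A' (\<lambda>U. F (insert f U))"
      unfolding determined_by_def EA by (auto intro!: determined_byD[OF Suc.prems(6)])
  qed
  have "wcov E w F G =
      wsum E w (\<lambda>_. 1) * (wcov E' w F G / wsum E' w (\<lambda>_. 1) +
        wcov E' w1 (\<lambda>U. F (insert f U)) G / wsum E' w1 (\<lambda>_. 1)) +
      wcov E w (occ f) F * wcov E w (occ f) G / (wsum E' w (\<lambda>_. 1) * wsum E' w1 (\<lambda>_. 1))"
    using wcov_decomposition[OF E(3,2), of w F G] Z(1,2)
    unfolding w1_def E(1)[symmetric] G1 by simp
  also have "\<dots> \<le> 0"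
  proof (rule add_nonpos_nonpos)
    show "wsum E w (\<lambda>_. 1) * (wcov E' w F G / wsum E' w (\<lambda>_. 1) +
        wcov E' w1 (\<lambda>U. F (insert f U)) G / wsum E' w1 (\<lambda>_. 1)) \<le> 0"
      using K0 K1 Z by (intro mult_nonneg_nonpos add_nonpos_nonpos divide_nonpos_pos) auto
    show "wcov E w (occ f) F * wcov E w (occ f) G / (wsum E' w (\<lambda>_. 1) * wsum E' w1 (\<lambda>_. 1)) \<le> 0"
      using fF fG Z by (intro divide_nonpos_pos mult_nonneg_nonpos) auto
  qed
  finally show ?case .
qed

text \<open>The induction is used twice: with the indicator of a single element in the role of \<open>G\<close>, which provides
its hypothesis for arbitrary increasing \<open>G\<close>.\<close>

lemma positive_stable_negatively_associated:
  assumes "positive_stable E w" "A \<subseteq> E" "B \<subseteq> E" "A \<inter> B = {}"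
    and "mono F" "determined_by A F" "mono G" "determined_by B G"
  shows "wcov E w F G \<le> 0"
proof (rule wcov_nonpos_induct[OF _ assms(8,1-6)])
  fix E :: "'a set" and w f assume *: "positive_stable E w" "B \<subseteq> E" "f \<in> E - B"
  have "wcov E w G (occ f) \<le> 0"
  proof (rule wcov_nonpos_induct[of "{f}", OF _ _ *(1,2) _ _ assms(7,8)])
    show "determined_by {f} (occ f)" by (simp add: determined_by_occ)
  next
    fix E :: "'a set" and w g assume "positive_stable E w" "{f} \<subseteq> E" "g \<in> E - {f}"
    then show "wcov E w (occ g) (occ f) \<le> 0" by (intro wcov_occ_occ_nonpos) auto
  qed (use * in auto)
  then show "wcov E w (occ f) G \<le> 0" by (simp add: wcov_commute)
qed


section \<open>From positive to nonnegative weights\<close>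

text \<open>Each element of a random set is independently flipped with probability \<open>r\<close>.\<close>

definition noise :: "'e set \<Rightarrow> real \<Rightarrow> ('e set \<Rightarrow> real) \<Rightarrow> 'e set \<Rightarrow> real" where
  "noise E r w U = (\<Sum>V\<in>Pow E. w V * (\<Prod>e\<in>E. if e \<in> U \<longleftrightarrow> e \<in> V then 1 - r else r))"

text \<open>Flipping with probability \<open>r\<close> acts on each variable by the Moebius map
\<open>z \<mapsto> ((1 - r) z + r) / (r z + 1 - r)\<close>; the product of the denominators restores a polynomial.\<close>

lemma multiaffine_noise:
  assumes fin: "finite E" and nz: "\<And>e. e \<in> E \<Longrightarrow> of_real r * z e + of_real (1 - r) \<noteq> 0"
  shows "multiaffine E (\<lambda>U. of_real (noise E r w U)) z =
    (\<Prod>e\<in>E. of_real r * z e + of_real (1 - r)) *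
    multiaffine E (\<lambda>U. of_real (w U))
      (\<lambda>e. (of_real (1 - r) * z e + of_real r) / (of_real r * z e + of_real (1 - r)))"
proof -
  define l where "l e = of_real r * z e + of_real (1 - r)" for e
  define m where "m e = of_real (1 - r) * z e + of_real r" for e
  have kernel: "(\<Sum>U\<in>Pow E. of_real (\<Prod>e\<in>E. if e \<in> U \<longleftrightarrow> e \<in> V then 1 - r else r) * (\<Prod>e\<in>U. z e)) =
      (\<Prod>e\<in>E. l e) * (\<Prod>e\<in>V. m e / l e)" if V: "V \<subseteq> E" for V
  proof -
    define p where "p e = z e * of_real (if e \<in> V then 1 - r else r)" for e
    define q where "q e = complex_of_real (if e \<in> V then r else 1 - r)" for e
    have step: "of_real (\<Prod>e\<in>E. if e \<in> U \<longleftrightarrow> e \<in> V then 1 - r else r) * (\<Prod>e\<in>U. z e) =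
        (\<Prod>e\<in>U. p e) * (\<Prod>e\<in>E - U. q e)" if "U \<in> Pow E" for U
    proof -
      have U: "U \<subseteq> E" using that by simp
      have "(\<Prod>e\<in>E. if e \<in> U \<longleftrightarrow> e \<in> V then 1 - r else r) =
        (\<Prod>e\<in>E - U. if e \<in> U \<longleftrightarrow> e \<in> V then 1 - r else r) * (\<Prod>e\<in>U. if e \<in> U \<longleftrightarrow> e \<in> V then 1 - r else r)"
        by (rule prod.subset_diff[OF U fin])
      also have "\<dots> = (\<Prod>e\<in>E - U. if e \<in> V then r else 1 - r) * (\<Prod>e\<in>U. if e \<in> V then 1 - r else r)"
        by (intro arg_cong2[where f = "(*)"] prod.cong) auto
      finally show ?thesis
        unfolding p_def q_def by (simp only: of_real_mult of_real_prod prod.distrib ac_simps)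
    qed
    have "(\<Sum>U\<in>Pow E. of_real (\<Prod>e\<in>E. if e \<in> U \<longleftrightarrow> e \<in> V then 1 - r else r) * (\<Prod>e\<in>U. z e)) =
        (\<Prod>e\<in>E. p e + q e)"
      unfolding prod_add[OF fin] by (intro sum.cong refl step)
    also have "\<dots> = (\<Prod>e\<in>E. l e * (if e \<in> V then m e / l e else 1))"
    proof (intro prod.cong refl)
      fix e assume "e \<in> E"
      then have "l e \<noteq> 0" using nz by (simp add: l_def)
      then show "p e + q e = l e * (if e \<in> V then m e / l e else 1)"
        by (cases "e \<in> V") (simp_all add: p_def q_def m_def, simp add: l_def mult.commute)
    qed
    also have "\<dots> = (\<Prod>e\<in>E. l e) * (\<Prod>e\<in>V. m e / l e)"
      using V fin by (simp add: prod.distrib prod.If_cases Int_absorb1)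
    finally show ?thesis .
  qed
  have "multiaffine E (\<lambda>U. of_real (noise E r w U)) z = (\<Sum>U\<in>Pow E. \<Sum>V\<in>Pow E.
      of_real (w V) * (of_real (\<Prod>e\<in>E. if e \<in> U \<longleftrightarrow> e \<in> V then 1 - r else r) * (\<Prod>e\<in>U. z e)))"
    unfolding multiaffine_def noise_def of_real_sum of_real_mult sum_distrib_right by (simp only: mult.assoc)
  also have "\<dots> = (\<Sum>V\<in>Pow E. of_real (w V) * (\<Sum>U\<in>Pow E.
      of_real (\<Prod>e\<in>E. if e \<in> U \<longleftrightarrow> e \<in> V then 1 - r else r) * (\<Prod>e\<in>U. z e)))"
    unfolding sum_distrib_left by (rule sum.swap)
  also have "\<dots> = (\<Sum>V\<in>Pow E. of_real (w V) * ((\<Prod>e\<in>E. l e) * (\<Prod>e\<in>V. m e / l e)))"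
    by (intro sum.cong refl arg_cong2[where f = "(*)"] kernel) auto
  also have "\<dots> = (\<Prod>e\<in>E. l e) * multiaffine E (\<lambda>U. of_real (w U)) (\<lambda>e. m e / l e)"
    unfolding multiaffine_def sum_distrib_left by (simp only: mult.left_commute)
  finally show ?thesis unfolding l_def m_def .
qed

text \<open>For \<open>r < 1 / 2\<close> the Moebius map has positive determinant \<open>1 - 2 r\<close>, so it preserves the upper half plane.
All weights become positive because every set can be reached from \<open>U0\<close> by flips.\<close>

lemma positive_stable_noise:
  assumes fin: "finite E" and nonneg: "\<And>U. U \<subseteq> E \<Longrightarrow> w U \<ge> 0"
    and pos: "U0 \<subseteq> E" "w U0 > 0"
    and st: "ma_stable E (\<lambda>U. of_real (w U))" and r: "0 < r" "r < 1 / 2"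
  shows "positive_stable E (noise E r w)"
proof -
  have "noise E r w U > 0" for U
    unfolding noise_def
  proof (rule sum_pos2[of _ U0])
    show "0 < w U0 * (\<Prod>e\<in>E. if (e \<in> U) = (e \<in> U0) then 1 - r else r)"
      using pos r by (intro mult_pos_pos prod_pos) auto
    fix V assume "V \<in> Pow E"
    then show "0 \<le> w V * (\<Prod>e\<in>E. if (e \<in> U) = (e \<in> V) then 1 - r else r)"
      using nonneg r by (intro mult_nonneg_nonneg prod_nonneg) auto
  qed (use pos fin in auto)
  moreover have "ma_stable E (\<lambda>U. of_real (noise E r w U))"
    unfolding ma_stable_def
  proof (intro allI impI)
    fix z assume z: "\<forall>e\<in>E. 0 < Im (z e)"
    define l where "l e = of_real r * z e + of_real (1 - r)" for e
    define m where "m e = of_real (1 - r) * z e + of_real r" for e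
    have "Im (l e) > 0" if "e \<in> E" for e using z that r by (simp add: l_def)
    then have l: "l e \<noteq> 0" if "e \<in> E" for e using that by force
    have "Im (m e / l e) > 0" if "e \<in> E" for e
    proof -
      have "Re (l e) ^ 2 + Im (l e) ^ 2 > 0" using l[OF that] by (metis complex_neq_0)
      moreover have "Im (m e) * Re (l e) - Re (m e) * Im (l e) = (1 - 2 * r) * Im (z e)"
        by (simp add: l_def m_def algebra_simps power2_eq_square)
      moreover have "(1 - 2 * r) * Im (z e) > 0" using r z that by simp
      ultimately show ?thesis by (simp add: Im_divide)
    qed
    then have "multiaffine E (\<lambda>U. of_real (w U)) (\<lambda>e. m e / l e) \<noteq> 0"
      using st[unfolded ma_stable_def, rule_format, of "\<lambda>e. m e / l e"] by simp
    moreover have "(\<Prod>e\<in>E. l e) \<noteq> 0" using l fin by simp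
    ultimately show "multiaffine E (\<lambda>U. of_real (noise E r w U)) z \<noteq> 0"
      using multiaffine_noise[OF fin l[unfolded l_def], where w = w] unfolding l_def m_def by simp
  qed
  ultimately show ?thesis using fin by (simp add: positive_stable_def)
qed

lemma noise_0: "finite E \<Longrightarrow> U \<subseteq> E \<Longrightarrow> noise E 0 w U = w U"
proof -
  assume fin: "finite E" and U: "U \<subseteq> E"
  have "(\<Prod>e\<in>E. if (e \<in> U) = (e \<in> V) then 1 - 0 else 0) = (if V = U then 1 else (0::real))"
    if "V \<in> Pow E" for V
    using that U fin by (auto simp: prod_zero_iff)
  then have "noise E 0 w U = (\<Sum>V\<in>Pow E. w V * (if V = U then 1 else 0))"
    unfolding noise_def by (intro sum.cong) auto
  also have "\<dots> = (\<Sum>V\<in>Pow E. if V = U then w V else 0)" by (intro sum.cong) auto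
  also have "\<dots> = w U" using U fin by (subst sum.delta) auto
  finally show ?thesis .
qed

theorem stable_weights_negatively_associated:
  assumes fin: "finite E" and nonneg: "\<And>U. U \<subseteq> E \<Longrightarrow> w U \<ge> 0"
    and nz: "wsum E w (\<lambda>_. 1) \<noteq> 0"
    and st: "ma_stable E (\<lambda>U. of_real (w U))"
    and FG: "A \<subseteq> E" "B \<subseteq> E" "A \<inter> B = {}" "mono F" "determined_by A F" "mono G" "determined_by B G"
  shows "wcov E w F G \<le> 0"
proof -
  obtain U0 where "U0 \<in> Pow E" "w U0 \<noteq> 0"
    using nz unfolding wsum_def by (metis (no_types, lifting) mult_zero_left sum.neutral)
  then have U0: "U0 \<subseteq> E" "w U0 > 0" using nonneg[of U0] by auto
  \<comment> \<open>Any null sequence in the open interval from \<open>0\<close> to \<open>1 / 2\<close> will do.\<close>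
  define r where "r n = inverse (real (Suc n)) / 3" for n
  have r: "0 < r n" "r n < 1 / 2" for n
    unfolding r_def using inverse_le_1_iff[of "real (Suc n)"] by (auto simp del: of_nat_Suc)
  have r0: "r \<longlonglongrightarrow> 0"
    unfolding r_def using tendsto_divide[OF LIMSEQ_inverse_real_of_nat tendsto_const, of 3] by simp
  have lim: "(\<lambda>n. noise E (r n) w U) \<longlonglongrightarrow> w U" if "U \<subseteq> E" for U
  proof -
    have "(\<lambda>n. noise E (r n) w U) \<longlonglongrightarrow> noise E 0 w U"
      unfolding noise_def
      by (intro tendsto_sum tendsto_mult tendsto_const tendsto_prod)
         (auto intro!: tendsto_eq_intros r0)
    then show ?thesis by (simp add: noise_0[OF fin that])
  qed
  have "(\<lambda>n. wsum E (noise E (r n) w) H) \<longlonglongrightarrow> wsum E w H" for H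
    unfolding wsum_def by (intro tendsto_intros lim) auto
  then have "(\<lambda>n. wcov E (noise E (r n) w) F G) \<longlonglongrightarrow> wcov E w F G"
    unfolding wcov_def by (intro tendsto_intros)
  moreover have "wcov E (noise E (r n) w) F G \<le> 0" for n
    by (rule positive_stable_negatively_associated[OF positive_stable_noise[OF fin nonneg U0 st r] FG])
  ultimately show ?thesis using LIMSEQ_le_const2 by blast
qed


section \<open>Polarization by differential operators\<close>

text \<open>A polynomial of degree at most \<open>d\<close> in each variable is represented by its coefficient function on the
box \<open>T \<rightarrow>\<^sub>E {..d}\<close> of exponents.\<close>

definition cpoly :: "'s set \<Rightarrow> nat \<Rightarrow> (('s \<Rightarrow> nat) \<Rightarrow> complex) \<Rightarrow> ('s \<Rightarrow> complex) \<Rightarrow> complex" where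
  "cpoly T d c y = (\<Sum>i\<in>T \<rightarrow>\<^sub>E {..d}. c i * (\<Prod>s\<in>T. y s ^ i s))"

definition deg_le :: "'s set \<Rightarrow> nat \<Rightarrow> (('s \<Rightarrow> nat) \<Rightarrow> complex) \<Rightarrow> bool" where
  "deg_le T d c \<longleftrightarrow> (\<forall>i\<in>T \<rightarrow>\<^sub>E UNIV. (\<exists>s\<in>T. i s > d) \<longrightarrow> c i = 0)"

definition cstable :: "'s set \<Rightarrow> nat \<Rightarrow> (('s \<Rightarrow> nat) \<Rightarrow> complex) \<Rightarrow> bool" where
  "cstable T d c \<longleftrightarrow> (\<forall>y. (\<forall>s\<in>T. Im (y s) > 0) \<longrightarrow> cpoly T d c y \<noteq> 0)"

definition pdiff :: "'s \<Rightarrow> (('s \<Rightarrow> nat) \<Rightarrow> complex) \<Rightarrow> ('s \<Rightarrow> nat) \<Rightarrow> complex" where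
  "pdiff s c i = of_nat (Suc (i s)) * c (i(s := Suc (i s)))"

text \<open>The coefficients of the mixed partial derivative of order \<open>k\<close>.\<close>

definition mdiff :: "'s set \<Rightarrow> ('s \<Rightarrow> nat) \<Rightarrow> (('s \<Rightarrow> nat) \<Rightarrow> complex) \<Rightarrow> ('s \<Rightarrow> nat) \<Rightarrow> complex" where
  "mdiff T k c i = (\<Prod>s\<in>T. pochhammer (of_nat (Suc (i s))) (k s)) * c (\<lambda>s\<in>T. i s + k s)"

lemma pderiv_finite_sum:
  "finite I \<Longrightarrow> pderiv (\<Sum>i\<in>I. f i) = (\<Sum>i\<in>I. pderiv (f i))"
  by (induction I rule: finite_induct) (simp_all add: pderiv_add)

text \<open>With all variables but one fixed, the polynomial is a univariate one, whose derivative is the partial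
derivative.\<close>

lemma cpoly_slice:
  assumes T: "finite T" "s \<in> T" and deg: "deg_le T d c"
  obtains q where "\<And>t. poly q t = cpoly T d c (y(s := t))"
    "poly (pderiv q) (y s) = cpoly T d (pdiff s c) y"
proof
  define R where "R i = (\<Prod>r\<in>T - {s}. y r ^ i r)" for i
  define q where "q = (\<Sum>i\<in>T \<rightarrow>\<^sub>E {..d}. monom (c i * R i) (i s))"
  have split: "(\<Prod>r\<in>T. (y(s := t)) r ^ i r) = t ^ i s * R i" for t i
    unfolding R_def using prod.remove[OF T, of "\<lambda>r. (y(s := t)) r ^ i r"] by simp
  show "poly q t = cpoly T d c (y(s := t))" for t
    unfolding q_def cpoly_def poly_sum poly_monom split by (simp add: algebra_simps)
  have fin: "finite (T \<rightarrow>\<^sub>E {..d})" using T by (simp add: finite_PiE)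
  have "poly (pderiv q) (y s) = (\<Sum>i\<in>T \<rightarrow>\<^sub>E {..d}. of_nat (i s) * (c i * R i) * y s ^ (i s - 1))"
    by (simp add: q_def pderiv_finite_sum[OF fin] pderiv_monom poly_sum poly_monom)
  also have "\<dots> = (\<Sum>i\<in>{i \<in> T \<rightarrow>\<^sub>E {..d}. 0 < i s}. of_nat (i s) * (c i * R i) * y s ^ (i s - 1))"
    using fin by (intro sum.mono_neutral_right) auto
  also have "\<dots> = (\<Sum>i\<in>{i \<in> T \<rightarrow>\<^sub>E {..d}. i s < d}.
      of_nat (Suc (i s)) * c (i(s := Suc (i s))) * (y s ^ i s * R i))"
  proof (rule sum.reindex_bij_witness
      [where i = "\<lambda>i. i(s := Suc (i s))" and j = "\<lambda>i. i(s := i s - 1)"])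
    fix i assume "i \<in> {i \<in> T \<rightarrow>\<^sub>E {..d}. 0 < i s}"
    then have i: "i \<in> T \<rightarrow>\<^sub>E {..d}" "i s > 0" by auto
    have "i s \<le> d" using i(1) T(2) by (auto simp: PiE_iff)
    show "(i(s := i s - 1))(s := Suc ((i(s := i s - 1)) s)) = i" using i(2) by auto
    show "i(s := i s - 1) \<in> {i \<in> T \<rightarrow>\<^sub>E {..d}. i s < d}"
      using i \<open>i s \<le> d\<close> T(2) by (auto simp: PiE_iff extensional_def le_diff_conv)
    have "R (i(s := i s - 1)) = R i" unfolding R_def by (intro prod.cong) auto
    then show "of_nat (Suc ((i(s := i s - 1)) s)) * c ((i(s := i s - 1))(s := Suc ((i(s := i s - 1)) s))) *
        (y s ^ (i(s := i s - 1)) s * R (i(s := i s - 1))) = of_nat (i s) * (c i * R i) * y s ^ (i s - 1)"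
      using i(2) by (simp add: algebra_simps)
  next
    fix i assume "i \<in> {i \<in> T \<rightarrow>\<^sub>E {..d}. i s < d}"
    then have i: "i \<in> T \<rightarrow>\<^sub>E {..d}" "i s < d" by auto
    show "(i(s := Suc (i s)))(s := (i(s := Suc (i s))) s - 1) = i" by simp
    show "i(s := Suc (i s)) \<in> {i \<in> T \<rightarrow>\<^sub>E {..d}. 0 < i s}"
      using i T(2) by (auto simp: PiE_iff extensional_def)
  qed
  also have "\<dots> = (\<Sum>i\<in>T \<rightarrow>\<^sub>E {..d}. of_nat (Suc (i s)) * c (i(s := Suc (i s))) * (y s ^ i s * R i))"
  proof (intro sum.mono_neutral_left ballI)
    fix i assume "i \<in> (T \<rightarrow>\<^sub>E {..d}) - {i \<in> T \<rightarrow>\<^sub>E {..d}. i s < d}"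
    then have i: "i \<in> T \<rightarrow>\<^sub>E {..d}" "d < Suc (i s)" by auto
    have "i(s := Suc (i s)) \<in> T \<rightarrow>\<^sub>E UNIV" using i(1) T(2) by (auto simp: PiE_iff extensional_def)
    then have "c (i(s := Suc (i s))) = 0"
      using deg i(2) T(2) unfolding deg_le_def by (metis fun_upd_same)
    then show "of_nat (Suc (i s)) * c (i(s := Suc (i s))) * (y s ^ i s * R i) = 0" by simp
  qed (use fin in auto)
  also have "\<dots> = cpoly T d (pdiff s c) y"
    unfolding cpoly_def pdiff_def using split[of "y s"] by simp
  finally show "poly (pderiv q) (y s) = cpoly T d (pdiff s c) y" .
qed

lemma cpoly_lincomb:
  "cpoly T d (\<lambda>i. c i + \<gamma> * c' i) y = cpoly T d c y + \<gamma> * cpoly T d c' y"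
  by (simp add: cpoly_def sum.distrib sum_distrib_left algebra_simps)

lemma cstable_add_pdiff:
  assumes "finite T" "s \<in> T" "deg_le T d c" "cstable T d c" "Im \<gamma> > 0"
  shows "cstable T d (\<lambda>i. c i + \<gamma> * pdiff s c i)"
  unfolding cstable_def
proof (intro allI impI)
  fix y assume y: "\<forall>s\<in>T. Im (y s) > 0"
  obtain q where q: "\<And>t. poly q t = cpoly T d c (y(s := t))"
    "poly (pderiv q) (y s) = cpoly T d (pdiff s c) y"
    using cpoly_slice[OF assms(1-3), of y] by blast
  have "poly q t \<noteq> 0" if "Im t > 0" for t
    unfolding q(1) using assms(4) y that unfolding cstable_def by auto
  then have "poly q (y s) + \<gamma> * poly (pderiv q) (y s) \<noteq> 0"
    using y assms(2,5) by (intro poly_add_smult_pderiv_nonzero) auto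
  then show "cpoly T d (\<lambda>i. c i + \<gamma> * pdiff s c i) y \<noteq> 0"
    unfolding cpoly_lincomb q by simp
qed

lemma cpoly_cong: "(\<And>i. i \<in> T \<rightarrow>\<^sub>E {..d} \<Longrightarrow> c i = c' i) \<Longrightarrow> cpoly T d c y = cpoly T d c' y"
  unfolding cpoly_def by (intro sum.cong) auto

lemma PiE_UNIV_mono: "i \<in> T \<rightarrow>\<^sub>E A \<Longrightarrow> i \<in> T \<rightarrow>\<^sub>E UNIV"
  by (auto simp: PiE_iff)

lemma mdiff_Suc:
  assumes "finite T" "s \<in> T"
  shows "mdiff T (k(s := Suc (k s))) c i = pdiff s (mdiff T k c) i"
proof -
  let ?i = "i(s := Suc (i s))"
  have "(\<Prod>r\<in>T. pochhammer (of_nat (Suc (i r))) ((k(s := Suc (k s))) r)) =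
    pochhammer (of_nat (Suc (i s))) (Suc (k s)) * (\<Prod>r\<in>T - {s}. pochhammer (of_nat (Suc (i r))) (k r) :: complex)"
    unfolding prod.remove[OF assms] by (intro arg_cong2[where f = "(*)"] prod.cong) auto
  moreover have "(\<Prod>r\<in>T. pochhammer (of_nat (Suc (?i r))) (k r)) =
    pochhammer (of_nat (Suc (Suc (i s)))) (k s) * (\<Prod>r\<in>T - {s}. pochhammer (of_nat (Suc (i r))) (k r) :: complex)"
    unfolding prod.remove[OF assms] by (intro arg_cong2[where f = "(*)"] prod.cong) auto
  moreover have "(\<lambda>r\<in>T. i r + (k(s := Suc (k s))) r) = (\<lambda>r\<in>T. ?i r + k r)" by auto
  ultimately show ?thesis
    unfolding mdiff_def pdiff_def by (simp add: pochhammer_rec algebra_simps)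
qed

lemma mdiff_zero: "i \<in> T \<rightarrow>\<^sub>E UNIV \<Longrightarrow> mdiff T (\<lambda>_. 0) c i = c i"
  by (simp add: mdiff_def PiE_iff extensional_restrict)

definition occupation :: "('e \<Rightarrow> 's) \<Rightarrow> 'e set \<Rightarrow> 's \<Rightarrow> nat" where
  "occupation \<sigma> U s = card {e \<in> U. \<sigma> e = s}"

lemma occupation_insert:
  assumes "finite U" "e \<notin> U"
  shows "occupation \<sigma> (insert e U) = (occupation \<sigma> U)(\<sigma> e := Suc (occupation \<sigma> U (\<sigma> e)))"
proof
  fix s
  have "{x \<in> insert e U. \<sigma> x = s} = (if \<sigma> e = s then insert e {x \<in> U. \<sigma> x = s} else {x \<in> U. \<sigma> x = s})"
    by auto
  then show "occupation \<sigma> (insert e U) s = ((occupation \<sigma> U)(\<sigma> e := Suc (occupation \<sigma> U (\<sigma> e)))) s"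
    using assms by (auto simp: occupation_def)
qed

lemma deg_le_mdiff: "deg_le T d c \<Longrightarrow> deg_le T d (mdiff T k c)"
  unfolding deg_le_def mdiff_def
proof (intro ballI impI)
  fix i :: "'a \<Rightarrow> nat"
  assume *: "\<forall>i\<in>T \<rightarrow>\<^sub>E UNIV. (\<exists>s\<in>T. d < i s) \<longrightarrow> c i = 0" "\<exists>s\<in>T. d < i s"
  then obtain s where "s \<in> T" "d < i s" by blast
  then have "\<exists>s\<in>T. d < (\<lambda>s\<in>T. i s + k s) s" by (intro bexI[of _ s]) auto
  then have "c (\<lambda>s\<in>T. i s + k s) = 0" using *(1) by auto
  then show "(\<Prod>s\<in>T. pochhammer (of_nat (Suc (i s))) (k s)) * c (\<lambda>s\<in>T. i s + k s) = 0" by simp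
qed

text \<open>Expanding the product of the commuting operators \<open>1 + z\<^sub>e \<partial>\<^sub>\<sigma>\<^sub>e\<close> over all slots \<open>e\<close> gives the sum over
\<open>U\<close>; the induction applies one operator at a time.\<close>

lemma cstable_polarized:
  assumes T: "finite T" and c: "deg_le T d c" "cstable T d c"
  shows "finite E \<Longrightarrow> \<sigma> ` E \<subseteq> T \<Longrightarrow> \<forall>e\<in>E. Im (z e) > 0 \<Longrightarrow>
    cstable T d (\<lambda>i. \<Sum>U\<in>Pow E. (\<Prod>e\<in>U. z e) * mdiff T (occupation \<sigma> U) c i)"
proof (induction E rule: finite_induct)
  case empty
  have "cpoly T d (\<lambda>i. mdiff T (\<lambda>_. 0) c i) y = cpoly T d c y" for y
    by (intro cpoly_cong mdiff_zero PiE_UNIV_mono)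
  then show ?case using c(2) by (simp add: cstable_def occupation_def[abs_def])
next
  case (insert e E)
  define C where "C = (\<lambda>i. \<Sum>U\<in>Pow E. (\<Prod>e\<in>U. z e) * mdiff T (occupation \<sigma> U) c i)"
  have "deg_le T d C"
    using deg_le_mdiff[OF c(1)] unfolding deg_le_def C_def by (auto intro!: sum.neutral)
  moreover have "cstable T d C" unfolding C_def using insert by simp
  ultimately have st: "cstable T d (\<lambda>i. C i + z e * pdiff (\<sigma> e) C i)"
    using insert.prems T by (intro cstable_add_pdiff) auto
  have "(\<Sum>U\<in>Pow (insert e E). (\<Prod>e\<in>U. z e) * mdiff T (occupation \<sigma> U) c i) =
      C i + z e * pdiff (\<sigma> e) C i" for i
  proof -
    have "(\<Prod>x\<in>insert e U. z x) * mdiff T (occupation \<sigma> (insert e U)) c i =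
        z e * ((\<Prod>x\<in>U. z x) * pdiff (\<sigma> e) (mdiff T (occupation \<sigma> U) c) i)" if "U \<in> Pow E" for U
    proof -
      have U: "finite U" "e \<notin> U" using that insert.hyps finite_subset by auto
      have "\<sigma> e \<in> T" using insert.prems by simp
      then show ?thesis using U by (simp add: occupation_insert mdiff_Suc[OF T])
    qed
    then show ?thesis
      unfolding sum_Pow_insert[OF insert.hyps] C_def pdiff_def
      by (simp add: sum_distrib_left algebra_simps del: of_nat_Suc)
  qed
  then show ?case using st by simp
qed

lemma cpoly_sum: "cpoly T d (\<lambda>i. \<Sum>U\<in>I. a U * m U i) y = (\<Sum>U\<in>I. cpoly T d (m U) y * a U)"
  unfolding cpoly_def
  by (simp add: sum_distrib_right sum_distrib_left algebra_simps) (rule sum.swap)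

text \<open>The polarized polynomial is evaluated at \<open>y = 0\<close>, which is reached along \<open>\<i> / n\<close>; there the derivative of
order \<open>k\<close> becomes \<open>k!\<close> times a coefficient.\<close>

lemma ma_stable_polarization:
  assumes T: "finite T" and c: "deg_le T d c" "cstable T d c" and E: "finite E" "\<sigma> ` E \<subseteq> T"
    and nz: "(\<Sum>U\<in>Pow E. (\<Prod>s\<in>T. fact (occupation \<sigma> U s)) * c (restrict (occupation \<sigma> U) T)) \<noteq> 0"
  shows "ma_stable E (\<lambda>U. (\<Prod>s\<in>T. fact (occupation \<sigma> U s)) * c (restrict (occupation \<sigma> U) T))"
proof (rule ma_stable_limit[OF E(1)])
  fix n
  let ?y = "\<lambda>_. \<i> / of_nat (Suc n)"
  show "ma_stable E (\<lambda>U. cpoly T d (mdiff T (occupation \<sigma> U) c) ?y)"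
    unfolding ma_stable_def
  proof (intro allI impI)
    fix z assume "\<forall>e\<in>E. 0 < Im (z e)"
    from cstable_polarized[OF T c E this] Im_i_div[of n]
    have "cpoly T d (\<lambda>i. \<Sum>U\<in>Pow E. (\<Prod>e\<in>U. z e) * mdiff T (occupation \<sigma> U) c i) ?y \<noteq> 0"
      unfolding cstable_def by simp
    then show "multiaffine E (\<lambda>U. cpoly T d (mdiff T (occupation \<sigma> U) c) ?y) z \<noteq> 0"
      unfolding cpoly_sum multiaffine_def .
  qed
next
  fix U
  have lim: "(\<lambda>n. cpoly T d b (\<lambda>_. \<i> / of_nat (Suc n))) \<longlonglongrightarrow> b (\<lambda>s\<in>T. 0)" for b
  proof -
    have "(\<lambda>n. cpoly T d b (\<lambda>_. \<i> / of_nat (Suc n))) \<longlonglongrightarrow> cpoly T d b (\<lambda>_. 0)"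
      unfolding cpoly_def by (intro tendsto_intros tendsto_i_div)
    moreover have "cpoly T d b (\<lambda>_. 0) = (\<Sum>i\<in>T \<rightarrow>\<^sub>E {..d}. if i = (\<lambda>s\<in>T. 0) then b i else 0)"
      unfolding cpoly_def
    proof (intro sum.cong refl)
      fix i assume i: "i \<in> T \<rightarrow>\<^sub>E {..d}"
      show "b i * (\<Prod>s\<in>T. 0 ^ i s) = (if i = (\<lambda>s\<in>T. 0) then b i else 0)"
      proof (cases "i = (\<lambda>s\<in>T. 0)")
        case False
        then obtain s where "s \<in> T" "i s \<noteq> 0" using i by (force simp: PiE_iff extensional_def)
        then have "(\<Prod>s\<in>T. (0::complex) ^ i s) = 0" using T by (auto simp: prod_zero_iff)
        then show ?thesis using False by simp
      qed simp
    qed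
    moreover have "\<dots> = b (\<lambda>s\<in>T. 0)"
      using T by (subst sum.delta) (auto simp: finite_PiE PiE_iff)
    ultimately show ?thesis by simp
  qed
  have "mdiff T k c (\<lambda>s\<in>T. 0) = (\<Prod>s\<in>T. fact (k s)) * c (restrict k T)" for k
  proof -
    have "(\<lambda>s\<in>T. (\<lambda>s\<in>T. 0) s + k s) = restrict k T" by auto
    then show ?thesis unfolding mdiff_def by (simp add: pochhammer_fact cong: prod.cong)
  qed
  then show "(\<lambda>n. cpoly T d (mdiff T (occupation \<sigma> U) c) (\<lambda>_. \<i> / of_nat (Suc n)))
      \<longlonglongrightarrow> (\<Prod>s\<in>T. fact (occupation \<sigma> U s)) * c (restrict (occupation \<sigma> U) T)"
    using lim by metis
qed (use nz in \<open>simp add: multiaffine_def\<close>)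

text \<open>Only the limit is known not to vanish at the point with all coordinates one; the approximants inherit
this eventually, which suffices for Hurwitz' theorem.\<close>

lemma ma_stable_polarization_limit:
  assumes T: "finite T" and c: "\<And>n. deg_le T (d n) (c n)" "\<And>n. cstable T (d n) (c n)"
    and lim: "\<And>i. i \<in> T \<rightarrow>\<^sub>E UNIV \<Longrightarrow> (\<lambda>n. c n i) \<longlonglongrightarrow> a i"
    and E: "finite E" "\<sigma> ` E \<subseteq> T"
    and nz: "(\<Sum>U\<in>Pow E. (\<Prod>s\<in>T. fact (occupation \<sigma> U s)) * a (restrict (occupation \<sigma> U) T)) \<noteq> 0"
  shows "ma_stable E (\<lambda>U. (\<Prod>s\<in>T. fact (occupation \<sigma> U s)) * a (restrict (occupation \<sigma> U) T))"
proof -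
  define v where "v n U = (\<Prod>s\<in>T. fact (occupation \<sigma> U s)) * c n (restrict (occupation \<sigma> U) T)" for n U
  have v: "(\<lambda>n. v n U) \<longlonglongrightarrow> (\<Prod>s\<in>T. fact (occupation \<sigma> U s)) * a (restrict (occupation \<sigma> U) T)" for U
    unfolding v_def by (intro tendsto_intros lim) auto
  have "(\<lambda>n. \<Sum>U\<in>Pow E. v n U) \<longlonglongrightarrow>
      (\<Sum>U\<in>Pow E. (\<Prod>s\<in>T. fact (occupation \<sigma> U s)) * a (restrict (occupation \<sigma> U) T))"
    by (intro tendsto_intros v)
  then have "\<forall>\<^sub>F n in sequentially. (\<Sum>U\<in>Pow E. v n U) \<noteq> 0"
    using nz by (rule tendsto_imp_eventually_ne)
  then obtain n0 where n0: "\<And>n. n \<ge> n0 \<Longrightarrow> (\<Sum>U\<in>Pow E. v n U) \<noteq> 0"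
    unfolding eventually_sequentially by blast
  show ?thesis
  proof (rule ma_stable_limit[OF E(1), of "\<lambda>n. v (n + n0)"])
    fix n show "ma_stable E (v (n + n0))"
      using ma_stable_polarization[OF T c E, of "n + n0"] n0[of "n + n0"] unfolding v_def[abs_def] by simp
  next
    fix U show "(\<lambda>n. v (n + n0) U) \<longlonglongrightarrow>
        (\<Prod>s\<in>T. fact (occupation \<sigma> U s)) * a (restrict (occupation \<sigma> U) T)"
      by (rule LIMSEQ_ignore_initial_segment[OF v])
  qed (use nz in \<open>simp add: multiaffine_def\<close>)
qed


section \<open>Coefficients of t-stable functions\<close>

lemma power_series_coeff_bound:
  fixes h :: "nat \<Rightarrow> complex"
  assumes q: "\<And>t. (\<lambda>n. h n * t ^ n) sums q t" and B: "\<And>t. norm t \<le> 1 \<Longrightarrow> norm (q t) \<le> B"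
  shows "norm (h n) \<le> B"
proof -
  have "q holomorphic_on ball 0 2"
    by (rule power_series_holomorphic[where a = h]) (use q in simp)
  then have hol: "q holomorphic_on cball 0 1" by (rule holomorphic_on_subset) auto
  have "q has_fps_expansion Abs_fps h"
    by (rule has_fps_expansionI) (use q in simp)
  then have "h n = (deriv ^^ n) q 0 / fact n"
    using fps_nth_fps_expansion[of q "Abs_fps h" n] by simp
  moreover have "norm ((deriv ^^ n) q 0) \<le> fact n * B / 1 ^ n"
    by (rule Cauchy_inequality)
       (use hol B in \<open>auto intro: holomorphic_on_subset holomorphic_on_imp_continuous_on\<close>)
  then have "norm ((deriv ^^ n) q 0) / fact n \<le> B" by (simp add: divide_le_eq mult.commute)
  ultimately show ?thesis by (simp add: norm_divide)
qed

text \<open>Cauchy's estimate, one variable at a time: for fixed values of the other variables the series is an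
entire power series in \<open>x s\<close>, whose \<open>n\<close>-th coefficient \<open>H n\<close> is again a power series with the same bound.\<close>

lemma multivariate_coeff_bound:
  fixes d :: "('s \<Rightarrow> nat) \<Rightarrow> complex"
  assumes "finite T"
    and "\<And>x. x \<in> T \<rightarrow>\<^sub>E UNIV \<Longrightarrow> ((\<lambda>i. d i * (\<Prod>s\<in>T. x s ^ i s)) has_sum h x) (T \<rightarrow>\<^sub>E UNIV)"
    and "\<And>x. x \<in> T \<rightarrow>\<^sub>E cball 0 1 \<Longrightarrow> norm (h x) \<le> B"
    and "k \<in> T \<rightarrow>\<^sub>E UNIV"
  shows "norm (d k) \<le> B"
  using assms
proof (induction T arbitrary: d h k rule: finite_induct)
  case empty
  have "k = (\<lambda>_. undefined)" using empty.prems(3) by simp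
  moreover have "((\<lambda>i. d i) has_sum h (\<lambda>_. undefined)) {\<lambda>_. undefined}"
    using empty.prems(1)[of "\<lambda>_. undefined"] by simp
  then have "h (\<lambda>_. undefined) = d (\<lambda>_. undefined)" by (simp add: has_sum_finite_iff)
  ultimately show ?case using empty.prems(2)[of "\<lambda>_. undefined"] by simp
next
  case (insert s T)
  define H where "H n x = infsum (\<lambda>i. d (i(s := n)) * (\<Prod>r\<in>T. x r ^ i r)) (T \<rightarrow>\<^sub>E UNIV)" for n x
  have prod_upd: "(\<Prod>r\<in>insert s T. (x(s := t)) r ^ (i(s := n)) r) = t ^ n * (\<Prod>r\<in>T. x r ^ i r)"
    for x :: "'s \<Rightarrow> complex" and t i n
  proof -
    have "(\<Prod>r\<in>T. (x(s := t)) r ^ (i(s := n)) r) = (\<Prod>r\<in>T. x r ^ i r)"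
      using insert.hyps by (intro prod.cong) auto
    then show ?thesis using insert.hyps by simp
  qed
  have sum2: "((\<lambda>(n, i). (d (i(s := n)) * (\<Prod>r\<in>T. x r ^ i r)) * t ^ n) has_sum h (x(s := t)))
      (UNIV \<times> (T \<rightarrow>\<^sub>E UNIV))" if "x \<in> T \<rightarrow>\<^sub>E UNIV" for x t
  proof -
    have "x(s := t) \<in> insert s T \<rightarrow>\<^sub>E UNIV" using that by (auto simp: PiE_iff extensional_def)
    from insert.prems(1)[OF this] have "((\<lambda>i. d i * (\<Prod>r\<in>insert s T. (x(s := t)) r ^ i r)) has_sum h (x(s := t)))
        ((\<lambda>(n, i). i(s := n)) ` (UNIV \<times> (T \<rightarrow>\<^sub>E UNIV)))"
      by (simp only: PiE_insert_eq)
    then have "((\<lambda>i. d i * (\<Prod>r\<in>insert s T. (x(s := t)) r ^ i r)) \<circ> (\<lambda>(n, i). i(s := n)) has_sum h (x(s := t)))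
        (UNIV \<times> (T \<rightarrow>\<^sub>E UNIV))"
      by (subst (asm) has_sum_reindex) (rule inj_combinator[OF insert.hyps(2)])
    moreover have "(\<lambda>i. d i * (\<Prod>r\<in>insert s T. (x(s := t)) r ^ i r)) \<circ> (\<lambda>(n, i). i(s := n)) =
        (\<lambda>(n, i). (d (i(s := n)) * (\<Prod>r\<in>T. x r ^ i r)) * t ^ n)"
      unfolding o_def case_prod_beta prod_upd by (simp add: mult_ac)
    ultimately show ?thesis by simp
  qed
  have Hsum: "((\<lambda>i. d (i(s := n)) * (\<Prod>r\<in>T. x r ^ i r)) has_sum H n x) (T \<rightarrow>\<^sub>E UNIV)"
    if x: "x \<in> T \<rightarrow>\<^sub>E UNIV" for n x
  proof -
    have "(\<lambda>(n, i). (d (i(s := n)) * (\<Prod>r\<in>T. x r ^ i r)) * 1 ^ n) summable_on (UNIV \<times> (T \<rightarrow>\<^sub>E UNIV))"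
      using sum2[OF x, of 1] unfolding summable_on_def by blast
    from summable_on_SigmaD1[OF this, of n]
    have "(\<lambda>i. d (i(s := n)) * (\<Prod>r\<in>T. x r ^ i r)) summable_on (T \<rightarrow>\<^sub>E UNIV)" by simp
    then show ?thesis unfolding H_def by simp
  qed
  have Hbound: "norm (H n x) \<le> B" if x: "x \<in> T \<rightarrow>\<^sub>E cball 0 1" for n x
  proof (rule power_series_coeff_bound)
    fix t
    have x': "x \<in> T \<rightarrow>\<^sub>E UNIV" using x by (rule PiE_UNIV_mono)
    have "((\<lambda>n. H n x * t ^ n) has_sum h (x(s := t))) UNIV"
      by (rule has_sum_SigmaD[OF sum2[OF x']]) (auto intro!: has_sum_cmult_left Hsum[OF x'])
    then show "(\<lambda>n. H n x * t ^ n) sums h (x(s := t))" by (rule has_sum_imp_sums)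
  next
    fix t :: complex assume "norm t \<le> 1"
    then have "x(s := t) \<in> insert s T \<rightarrow>\<^sub>E cball 0 1" using x by (auto simp: PiE_iff extensional_def)
    then show "norm (h (x(s := t))) \<le> B" by (rule insert.prems(2))
  qed
  have k: "restrict k T \<in> T \<rightarrow>\<^sub>E UNIV" by simp
  have "(restrict k T)(s := k s) = k"
    using insert.prems(3) insert.hyps by (auto simp: PiE_iff extensional_def fun_eq_iff)
  then show ?case using insert.IH[OF Hsum Hbound k, of "k s"] by (simp only:)
qed

text \<open>The degree bound only has to exist; the sum of all exponents serves.\<close>

lemma mpoly_as_cpoly:
  assumes T: "finite T" and vars: "mpoly_vars p \<subseteq> T"
  obtains d c where "deg_le T d c" "\<And>x. cpoly T d c x = mpoly_eval p x"
proof -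
  define \<psi> where "\<psi> i = Abs_poly_mapping (\<lambda>s. if s \<in> T then i s else (0::nat))" for i
  have \<psi>: "Poly_Mapping.lookup (\<psi> i) = (\<lambda>s. if s \<in> T then i s else 0)" for i
    unfolding \<psi>_def by (rule Abs_poly_mapping_inverse) (use T in simp)
  define \<phi> where "\<phi> m = restrict (Poly_Mapping.lookup m) T" for m :: "'a \<Rightarrow>\<^sub>0 nat"
  have sub: "Poly_Mapping.keys m \<subseteq> T" if "m \<in> Poly_Mapping.keys p" for m
    using vars that by (auto simp: mpoly_vars_def)
  have \<psi>\<phi>: "\<psi> (\<phi> m) = m" if "m \<in> Poly_Mapping.keys p" for m
    using sub[OF that] by (intro poly_mapping_eqI) (auto simp: \<psi> \<phi>_def in_keys_iff)
  have \<phi>\<psi>: "\<phi> (\<psi> i) = i" if "i \<in> T \<rightarrow>\<^sub>E UNIV" for i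
    using that by (auto simp: \<psi> \<phi>_def PiE_iff extensional_def fun_eq_iff)
  define c where "c i = Poly_Mapping.lookup p (\<psi> i)" for i
  define d where "d = (\<Sum>m\<in>Poly_Mapping.keys p. \<Sum>s\<in>T. Poly_Mapping.lookup m s)"
  have le_d: "Poly_Mapping.lookup m s \<le> d" if "m \<in> Poly_Mapping.keys p" "s \<in> T" for m s
  proof -
    have "Poly_Mapping.lookup m s \<le> (\<Sum>s\<in>T. Poly_Mapping.lookup m s)"
      using that T by (intro member_le_sum) auto
    also have "\<dots> \<le> d" unfolding d_def using that
      by (intro member_le_sum[of m _ "\<lambda>m. \<Sum>s\<in>T. Poly_Mapping.lookup m s"]) auto
    finally show ?thesis .
  qed
  have c0: "\<psi> i \<in> Poly_Mapping.keys p" if "c i \<noteq> 0" for i using that by (simp add: c_def in_keys_iff)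
  have "deg_le T d c"
    unfolding deg_le_def
  proof (intro ballI impI)
    fix i assume "\<exists>s\<in>T. d < i s"
    then obtain s where s: "s \<in> T" "d < i s" by blast
    show "c i = 0"
    proof (rule ccontr)
      assume "c i \<noteq> 0"
      then show False using le_d[OF c0 s(1)] s by (force simp: \<psi>)
    qed
  qed
  moreover have "cpoly T d c x = mpoly_eval p x" for x
  proof -
    have "cpoly T d c x = (\<Sum>i\<in>\<phi> ` Poly_Mapping.keys p. c i * (\<Prod>s\<in>T. x s ^ i s))"
      unfolding cpoly_def
    proof (rule sum.mono_neutral_right)
      show "finite (T \<rightarrow>\<^sub>E {..d})" using T by (simp add: finite_PiE)
      show "\<phi> ` Poly_Mapping.keys p \<subseteq> T \<rightarrow>\<^sub>E {..d}" using le_d by (auto simp: \<phi>_def)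
      show "\<forall>i\<in>(T \<rightarrow>\<^sub>E {..d}) - \<phi> ` Poly_Mapping.keys p. c i * (\<Prod>s\<in>T. x s ^ i s) = 0"
      proof
        fix i assume i: "i \<in> (T \<rightarrow>\<^sub>E {..d}) - \<phi> ` Poly_Mapping.keys p"
        then have "\<phi> (\<psi> i) = i" by (intro \<phi>\<psi>) (auto intro: PiE_UNIV_mono)
        then have "c i = 0" using i c0[of i] by (metis DiffD2 imageI)
        then show "c i * (\<Prod>s\<in>T. x s ^ i s) = 0" by simp
      qed
    qed
    also have "\<dots> = (\<Sum>m\<in>Poly_Mapping.keys p. c (\<phi> m) * (\<Prod>s\<in>T. x s ^ \<phi> m s))"
      by (rule sum.reindex_cong[of \<phi>]) (auto intro: inj_on_inverseI[of _ \<psi>] \<psi>\<phi>)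
    also have "\<dots> = mpoly_eval p x"
      unfolding mpoly_eval_def
    proof (intro sum.cong refl arg_cong2[where f = "(*)"])
      fix m assume m: "m \<in> Poly_Mapping.keys p"
      show "c (\<phi> m) = Poly_Mapping.lookup p m" by (simp add: c_def \<psi>\<phi>[OF m])
      show "(\<Prod>s\<in>T. x s ^ \<phi> m s) = (\<Prod>s\<in>Poly_Mapping.keys m. x s ^ Poly_Mapping.lookup m s)"
        using sub[OF m] T by (intro prod.mono_neutral_cong_right) (auto simp: \<phi>_def in_keys_iff subset_iff)
    qed
    finally show ?thesis .
  qed
  ultimately show ?thesis using that by blast
qed

lemma stable_poly_imp_cstable:
  assumes "stable_poly T p" "\<And>x. cpoly T d c x = mpoly_eval p x"
  shows "cstable T d c"
  unfolding cstable_def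
proof (intro allI impI)
  fix y assume y: "\<forall>s\<in>T. 0 < Im (y s)"
  have "cpoly T d c y = cpoly T d c (restrict y T)"
    unfolding cpoly_def by (intro sum.cong refl arg_cong2[where f = "(*)"] prod.cong) auto
  also have "\<dots> = mpoly_eval p (restrict y T)" by (rule assms(2))
  also have "\<dots> \<noteq> 0" using assms(1) y unfolding stable_poly_def by auto
  finally show "cpoly T d c y \<noteq> 0" .
qed

lemma cpoly_has_sum:
  assumes T: "finite T" and deg: "deg_le T d c"
  shows "((\<lambda>i. c i * (\<Prod>s\<in>T. x s ^ i s)) has_sum cpoly T d c x) (T \<rightarrow>\<^sub>E UNIV)"
proof -
  have "((\<lambda>i. c i * (\<Prod>s\<in>T. x s ^ i s)) has_sum cpoly T d c x) (T \<rightarrow>\<^sub>E {..d})"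
    unfolding cpoly_def by (rule has_sum_finite) (use T in \<open>simp add: finite_PiE\<close>)
  also have "?this \<longleftrightarrow> ?thesis"
  proof (rule has_sum_cong_neutral)
    fix i assume "i \<in> (T \<rightarrow>\<^sub>E UNIV) - (T \<rightarrow>\<^sub>E {..d})"
    then have "i \<in> T \<rightarrow>\<^sub>E UNIV" "\<exists>s\<in>T. d < i s" by (auto simp: PiE_iff not_le)
    then have "c i = 0" using deg unfolding deg_le_def by blast
    then show "c i * (\<Prod>s\<in>T. x s ^ i s) = 0" by simp
  qed (auto simp: PiE_iff)
  finally show ?thesis .
qed

text \<open>Uniform convergence on the closed unit polydisc controls every coefficient of the difference between an
approximating polynomial and \<open>f\<close>.\<close>

lemma tstable_fun_coefficients:
  assumes T: "finite T" and f: "tstable_fun T f"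
    and a: "\<And>x. x \<in> T \<rightarrow>\<^sub>E UNIV \<Longrightarrow> ((\<lambda>i. a i * (\<Prod>s\<in>T. x s ^ i s)) has_sum f x) (T \<rightarrow>\<^sub>E UNIV)"
  obtains d c where "\<And>n. deg_le T (d n) (c n)" "\<And>n. cstable T (d n) (c n)"
    "\<And>i. i \<in> T \<rightarrow>\<^sub>E UNIV \<Longrightarrow> (\<lambda>n. c n i) \<longlonglongrightarrow> a i"
proof -
  obtain p where st: "\<And>m. stable_poly T (p m)"
    and ul: "\<And>K. compactin (product_topology (\<lambda>_. euclidean) T) K \<Longrightarrow>
        uniform_limit K (\<lambda>m. mpoly_eval (p m)) f sequentially"
    using f unfolding tstable_fun_def by blast
  have "\<exists>d c. deg_le T d c \<and> (\<forall>x. cpoly T d c x = mpoly_eval (p m) x)" for m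
    using mpoly_as_cpoly[OF T, of "p m"] st[of m] unfolding stable_poly_def by metis
  then obtain d c where dc: "\<And>m. deg_le T (d m) (c m)" "\<And>m x. cpoly T (d m) (c m) x = mpoly_eval (p m) x"
    by metis
  have K: "compactin (product_topology (\<lambda>_. euclidean) T) (T \<rightarrow>\<^sub>E (cball 0 1 :: complex set))"
    by (subst compactin_PiE) auto
  have "(\<lambda>m. c m i) \<longlonglongrightarrow> a i" if i: "i \<in> T \<rightarrow>\<^sub>E UNIV" for i
    unfolding tendsto_iff
  proof (intro allI impI)
    fix e :: real assume e: "e > 0"
    have "\<forall>\<^sub>F m in sequentially. \<forall>x\<in>T \<rightarrow>\<^sub>E cball 0 1. dist (mpoly_eval (p m) x) (f x) < e / 2"
      using uniform_limitD[OF ul[OF K], of "e / 2"] e by simp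
    then show "\<forall>\<^sub>F m in sequentially. dist (c m i) (a i) < e"
    proof (rule eventually_mono)
      fix m assume m: "\<forall>x\<in>T \<rightarrow>\<^sub>E cball 0 1. dist (mpoly_eval (p m) x) (f x) < e / 2"
      have "norm (c m i - a i) \<le> e / 2"
      proof (rule multivariate_coeff_bound[OF T _ _ i])
        fix x :: "'a \<Rightarrow> complex" assume "x \<in> T \<rightarrow>\<^sub>E UNIV"
        from has_sum_add[OF cpoly_has_sum[OF T dc(1)[of m], of x] has_sum_cmult_right[OF a[OF this], of "-1"]]
        show "((\<lambda>i. (c m i - a i) * (\<Prod>s\<in>T. x s ^ i s)) has_sum (mpoly_eval (p m) x - f x)) (T \<rightarrow>\<^sub>E UNIV)"
          by (simp add: dc(2) left_diff_distrib)
      next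
        fix x :: "'a \<Rightarrow> complex" assume "x \<in> T \<rightarrow>\<^sub>E cball 0 1"
        then show "norm (mpoly_eval (p m) x - f x) \<le> e / 2" using m by (simp add: dist_norm less_imp_le)
      qed
      then show "dist (c m i) (a i) < e" using e by (simp add: dist_norm)
    qed
  qed
  then show ?thesis using that dc(1) stable_poly_imp_cstable[OF st dc(2)] by blast
qed


section \<open>Finitely many coordinates\<close>

lemma occupation_fst: "occupation fst U s = card {j. (s, j) \<in> U}"
proof -
  have "{e \<in> U. fst e = s} = Pair s ` {j. (s, j) \<in> U}" by force
  then show ?thesis unfolding occupation_def by (simp add: card_image inj_on_def)
qed

lemma card_eq_sum_occupation:
  assumes "finite T" "U \<subseteq> T \<times> {..<N::nat}"
  shows "card U = (\<Sum>s\<in>T. occupation fst U s)"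
proof -
  have "U = (SIGMA s:T. {j. (s, j) \<in> U})" using assms(2) by auto
  moreover have "finite {j. (s, j) \<in> U}" for s
    by (rule finite_subset[of _ "{..<N}"]) (use assms(2) in auto)
  ultimately have "card U = (\<Sum>s\<in>T. card {j. (s, j) \<in> U})"
    using card_SigmaI[of T "\<lambda>s. {j. (s, j) \<in> U}"] assms(1) by simp
  then show ?thesis by (simp add: occupation_fst)
qed

text \<open>The slots are chosen independently at each site.\<close>

lemma card_occupation_fibre:
  assumes T: "finite T" and i: "i \<in> T \<rightarrow>\<^sub>E UNIV"
  shows "card {U \<in> Pow (T \<times> {..<N}). restrict (occupation fst U) T = i} = (\<Prod>s\<in>T. N choose i s)"
proof -
  define V where "V = (\<Pi>\<^sub>E s\<in>T. {W. W \<subseteq> {..<N} \<and> card W = i s})"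
  have "bij_betw (\<lambda>U. \<lambda>s\<in>T. {j. (s, j) \<in> U})
      {U \<in> Pow (T \<times> {..<N}). restrict (occupation fst U) T = i} V"
  proof (rule bij_betw_byWitness[where f' = "Sigma T"])
    show "\<forall>U\<in>{U \<in> Pow (T \<times> {..<N}). restrict (occupation fst U) T = i}.
        Sigma T (\<lambda>s\<in>T. {j. (s, j) \<in> U}) = U" by auto
    show "\<forall>W\<in>V. (\<lambda>s\<in>T. {j. (s, j) \<in> Sigma T W}) = W"
      by (auto simp: V_def PiE_iff extensional_def fun_eq_iff)
    show "(\<lambda>U. \<lambda>s\<in>T. {j. (s, j) \<in> U}) ` {U \<in> Pow (T \<times> {..<N}). restrict (occupation fst U) T = i} \<subseteq> V"
      unfolding V_def by (auto simp: occupation_fst)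
    show "Sigma T ` V \<subseteq> {U \<in> Pow (T \<times> {..<N}). restrict (occupation fst U) T = i}"
    proof
      fix U assume "U \<in> Sigma T ` V"
      then obtain W where W: "W \<in> V" "U = Sigma T W" by blast
      have "(\<lambda>s\<in>T. card {j. (s, j) \<in> Sigma T W}) = i"
        using W(1) i by (auto simp: V_def PiE_iff extensional_def fun_eq_iff)
      then have "restrict (occupation fst U) T = i" by (simp add: W(2) occupation_fst[abs_def])
      moreover have "U \<subseteq> T \<times> {..<N}" using W by (auto simp: V_def PiE_iff)
      ultimately show "U \<in> {U \<in> Pow (T \<times> {..<N}). restrict (occupation fst U) T = i}" by simp
    qed
  qed
  then have "card {U \<in> Pow (T \<times> {..<N}). restrict (occupation fst U) T = i} = card V"
    by (rule bij_betw_same_card)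
  also have "\<dots> = (\<Prod>s\<in>T. N choose i s)"
    unfolding V_def card_PiE[OF T] by (simp add: n_subsets)
  finally show ?thesis .
qed

text \<open>The falling factorial \<open>N (N - 1) \<dots> (N - k + 1)\<close> divided by \<open>N ^ k\<close>; it vanishes for \<open>k > N\<close>.\<close>

definition falling_ratio :: "nat \<Rightarrow> nat \<Rightarrow> real" where
  "falling_ratio N k = fact k * real (N choose k) / real N ^ k"

lemma falling_ratio_bounds: "0 \<le> falling_ratio N k" "falling_ratio N k \<le> 1"
proof -
  show "0 \<le> falling_ratio N k" by (simp add: falling_ratio_def)
  have "real (N choose k) * fact k = real ((N choose k) * fact k)" by simp
  also have "\<dots> \<le> real (N ^ k)" by (rule of_nat_mono[OF binomial_fact_pow])
  finally show "falling_ratio N k \<le> 1"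
    by (cases "N = 0 \<and> k > 0") (auto simp: falling_ratio_def divide_le_eq mult.commute)
qed

lemma falling_ratio_tendsto: "(\<lambda>N. falling_ratio N k) \<longlonglongrightarrow> 1"
proof -
  have "(\<lambda>N. \<Prod>i = 0..<k. 1 - real i * inverse (real N)) \<longlonglongrightarrow> (\<Prod>i = 0..<k. 1 - real i * 0)"
    by (intro tendsto_intros lim_inverse_n)
  moreover have "\<forall>\<^sub>F N in sequentially. (\<Prod>i = 0..<k. 1 - real i * inverse (real N)) = falling_ratio N k"
  proof (rule eventually_sequentiallyI[of 1])
    fix N :: nat assume N: "N \<ge> 1"
    have "falling_ratio N k = (\<Prod>i = 0..<k. real N - real i) / real N ^ k"
      unfolding falling_ratio_def binomial_gbinomial gbinomial_prod_rev by simp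
    also have "\<dots> = (\<Prod>i = 0..<k. (real N - real i) / real N)" by (simp add: prod_dividef)
    also have "\<dots> = (\<Prod>i = 0..<k. 1 - real i * inverse (real N))"
      using N by (intro prod.cong) (auto simp: field_simps)
    finally show "(\<Prod>i = 0..<k. 1 - real i * inverse (real N)) = falling_ratio N k" by simp
  qed
  ultimately show ?thesis using Lim_transform_eventually by force
qed

text \<open>The weight of a configuration of slots depends only on the occupation numbers \<open>i\<close>, and there are
\<open>\<Prod>\<^sub>s (N choose i s)\<close> configurations with these numbers.\<close>

lemma wsum_polarized:
  fixes a :: "('s \<Rightarrow> nat) \<Rightarrow> real"
  assumes T: "finite T"
  shows "wsum (T \<times> {..<N})
      (\<lambda>U. (\<Prod>s\<in>T. fact (occupation fst U s)) * a (restrict (occupation fst U) T) / real N ^ card U)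
      (\<lambda>U. \<Phi> (restrict (occupation fst U) T)) =
    (\<Sum>i\<in>T \<rightarrow>\<^sub>E {..N}. a i * (\<Prod>s\<in>T. falling_ratio N (i s)) * \<Phi> i)"
proof -
  let ?k = "\<lambda>U. restrict (occupation fst U) T"
  define g where "g i = (\<Prod>s\<in>T. fact (i s) / real N ^ i s) * a i * \<Phi> i" for i
  have "wsum (T \<times> {..<N})
      (\<lambda>U. (\<Prod>s\<in>T. fact (occupation fst U s)) * a (?k U) / real N ^ card U) (\<lambda>U. \<Phi> (?k U)) =
    (\<Sum>U\<in>Pow (T \<times> {..<N}). g (?k U))"
    unfolding wsum_def
  proof (intro sum.cong refl)
    fix U assume "U \<in> Pow (T \<times> {..<N})"
    then have "real N ^ card U = (\<Prod>s\<in>T. real N ^ occupation fst U s)"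
      using card_eq_sum_occupation[OF T, of U N] by (simp add: power_sum)
    then show "(\<Prod>s\<in>T. fact (occupation fst U s)) * a (?k U) / real N ^ card U * \<Phi> (?k U) = g (?k U)"
      unfolding g_def by (simp add: prod_dividef cong: prod.cong)
  qed
  also have "\<dots> = (\<Sum>i\<in>T \<rightarrow>\<^sub>E {..N}. real (card {U \<in> Pow (T \<times> {..<N}). ?k U = i}) * g i)"
  proof (rule sum_fun_comp)
    show "?k ` Pow (T \<times> {..<N}) \<subseteq> T \<rightarrow>\<^sub>E {..N}"
    proof clarify
      fix U assume U: "U \<subseteq> T \<times> {..<N}"
      have "card {j. (s, j) \<in> U} \<le> N" for s
        using card_mono[of "{..<N}" "{j. (s, j) \<in> U}"] U by auto
      then show "?k U \<in> T \<rightarrow>\<^sub>E {..N}" by (simp add: occupation_fst)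
    qed
  qed (use T in \<open>auto simp: finite_PiE\<close>)
  also have "\<dots> = (\<Sum>i\<in>T \<rightarrow>\<^sub>E {..N}. a i * (\<Prod>s\<in>T. falling_ratio N (i s)) * \<Phi> i)"
  proof (intro sum.cong refl)
    fix i assume "i \<in> T \<rightarrow>\<^sub>E {..N}"
    then have "real (card {U \<in> Pow (T \<times> {..<N}). ?k U = i}) = (\<Prod>s\<in>T. real (N choose i s))"
      using card_occupation_fibre[OF T PiE_UNIV_mono, of i "{..N}" N] by simp
    then show "real (card {U \<in> Pow (T \<times> {..<N}). ?k U = i}) * g i = a i * (\<Prod>s\<in>T. falling_ratio N (i s)) * \<Phi> i"
      unfolding g_def falling_ratio_def by (simp add: prod_dividef prod.distrib mult_ac)
  qed
  finally show ?thesis .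
qed

lemma integral_finite_support:
  fixes g :: "'a \<Rightarrow> real"
  assumes "finite_measure M" "finite B" "\<And>b. b \<in> B \<Longrightarrow> {b} \<in> sets M"
    and "\<And>x. x \<in> space M \<Longrightarrow> x \<notin> B \<Longrightarrow> g x = 0"
  shows "(\<integral>x. g x \<partial>M) = (\<Sum>b\<in>B. measure M {b} * g b)"
proof -
  interpret finite_measure M by fact
  have "(\<integral>x. g x \<partial>M) = (\<integral>x. (\<Sum>b\<in>B. g b * indicator {b} x) \<partial>M)"
  proof (intro Bochner_Integration.integral_cong refl)
    fix x assume "x \<in> space M"
    then show "g x = (\<Sum>b\<in>B. g b * indicator {b} x)"
      using assms(2,4) by (cases "x \<in> B") (auto simp: indicator_def if_distrib sum.delta cong: if_cong)
  qed
  also have "\<dots> = (\<Sum>b\<in>B. \<integral>x. g b * indicator {b} x \<partial>M)"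
    using assms(3) by (intro Bochner_Integration.integral_sum) (auto simp: less_top[symmetric])
  also have "\<dots> = (\<Sum>b\<in>B. measure M {b} * g b)"
    using assms(3) by (intro sum.cong) (auto simp: mult.commute Int_absorb2 sets.sets_into_space)
  finally show ?thesis .
qed

text \<open>The expectations under the weights on \<open>N\<close> slots per site are integrals with the additional density
\<open>tr N\<close>, which lies in \<open>[0, 1]\<close> and tends to \<open>1\<close>.\<close>

theorem finite_negatively_associated:
  fixes \<nu> :: "('s \<Rightarrow> nat) measure"
  assumes T: "finite T" and "prob_space \<nu>" and sets: "sets \<nu> = sets (nat_families T)"
    and st: "tstable_measure_fin T \<nu>"
    and AB: "A \<subseteq> T" "B \<subseteq> T" "A \<inter> B = {}"
    and dep: "depends_only_on T A F" "depends_only_on T B G"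
    and mono: "mono_on (T \<rightarrow>\<^sub>E UNIV) F" "mono_on (T \<rightarrow>\<^sub>E UNIV) G"
    and int: "integrable \<nu> F" "integrable \<nu> G" "integrable \<nu> (\<lambda>x. F x * G x)"
  shows "(\<integral>x. F x * G x \<partial>\<nu>) \<le> (\<integral>x. F x \<partial>\<nu>) * (\<integral>x. G x \<partial>\<nu>)"
proof -
  interpret prob_space \<nu> by fact
  have space: "space \<nu> = T \<rightarrow>\<^sub>E UNIV" using sets_eq_imp_space_eq[OF sets] by (simp add: space_PiM)
  define a where "a i = measure \<nu> {i}" for i
  define tr where "tr N x = (\<Prod>s\<in>T. falling_ratio N (x s))" for N and x :: "'s \<Rightarrow> nat"
  define S where "S N \<Phi> = (\<Sum>i\<in>T \<rightarrow>\<^sub>E {..N}. a i * tr N i * \<Phi> i)" for N \<Phi>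
  have singleton: "{i} \<in> sets \<nu>" if "i \<in> T \<rightarrow>\<^sub>E UNIV" for i
  proof -
    have "{i} = (\<Pi>\<^sub>E s\<in>T. {i s})" using that by (intro PiE_singleton[symmetric]) (simp add: PiE_iff)
    also have "\<dots> \<in> sets (nat_families T)" by (rule sets_PiM_I_finite[OF T]) auto
    finally show ?thesis by (simp add: sets)
  qed
  have lim: "(\<lambda>N. S N \<Phi>) \<longlonglongrightarrow> (\<integral>x. \<Phi> x \<partial>\<nu>)" if \<Phi>: "integrable \<nu> \<Phi>" for \<Phi>
  proof -
    have "S N \<Phi> = (\<integral>x. tr N x * \<Phi> x \<partial>\<nu>)" for N
    proof -
      have "(\<integral>x. tr N x * \<Phi> x \<partial>\<nu>) = (\<Sum>i\<in>T \<rightarrow>\<^sub>E {..N}. measure \<nu> {i} * (tr N i * \<Phi> i))"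
      proof (rule integral_finite_support)
        fix x assume "x \<in> space \<nu>" "x \<notin> T \<rightarrow>\<^sub>E {..N}"
        then obtain s where "s \<in> T" "x s > N" by (auto simp: space PiE_iff not_le)
        then have "falling_ratio N (x s) = 0" by (simp add: falling_ratio_def)
        then show "tr N x * \<Phi> x = 0" using \<open>s \<in> T\<close> T by (auto simp: tr_def prod_zero_iff)
      next
        show "{i} \<in> sets \<nu>" if "i \<in> T \<rightarrow>\<^sub>E {..N}" for i
          by (rule singleton[OF PiE_UNIV_mono[OF that]])
      qed (use T in \<open>auto simp: finite_PiE finite_measure_axioms\<close>)
      then show ?thesis by (simp add: S_def a_def mult_ac)
    qed
    moreover have "(\<lambda>N. \<integral>x. tr N x * \<Phi> x \<partial>\<nu>) \<longlonglongrightarrow> (\<integral>x. \<Phi> x \<partial>\<nu>)"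
    proof (rule integral_dominated_convergence[where w = "\<lambda>x. norm (\<Phi> x)"])
      show "\<Phi> \<in> borel_measurable \<nu>" using \<Phi> by simp
      have "tr N \<in> borel_measurable \<nu>" for N
        unfolding tr_def measurable_cong_sets[OF sets refl]
        by (intro borel_measurable_prod measurable_compose[OF measurable_component_singleton]) auto
      then show "(\<lambda>x. tr N x * \<Phi> x) \<in> borel_measurable \<nu>" for N using \<Phi> by simp
      show "integrable \<nu> (\<lambda>x. norm (\<Phi> x))" using \<Phi> by simp
      have "(\<lambda>N. tr N x * \<Phi> x) \<longlonglongrightarrow> (\<Prod>s\<in>T. 1) * \<Phi> x" for x
        unfolding tr_def by (intro tendsto_intros falling_ratio_tendsto)
      then show "AE x in \<nu>. (\<lambda>N. tr N x * \<Phi> x) \<longlonglongrightarrow> \<Phi> x" by simp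
      have "0 \<le> tr N x" "tr N x \<le> 1" for N x
        unfolding tr_def by (auto intro!: prod_nonneg prod_le_1 simp: falling_ratio_bounds)
      then show "AE x in \<nu>. norm (tr N x * \<Phi> x) \<le> norm (\<Phi> x)" for N
        by (simp add: abs_mult mult_left_le_one_le)
    qed
    ultimately show ?thesis by simp
  qed
  obtain f where f: "tstable_fun T f"
    "\<And>x. x \<in> T \<rightarrow>\<^sub>E UNIV \<Longrightarrow> ((\<lambda>i. complex_of_real (a i) * (\<Prod>s\<in>T. x s ^ i s)) has_sum f x) (T \<rightarrow>\<^sub>E UNIV)"
    using st unfolding tstable_measure_fin_def a_def by blast
  obtain d c where dc: "\<And>n. deg_le T (d n) (c n)" "\<And>n. cstable T (d n) (c n)"
    "\<And>i. i \<in> T \<rightarrow>\<^sub>E UNIV \<Longrightarrow> (\<lambda>n. c n i) \<longlonglongrightarrow> complex_of_real (a i)"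
    using tstable_fun_coefficients[OF T f] by blast
  have ineq: "S N (\<lambda>_. 1) * S N (\<lambda>x. F x * G x) \<le> S N F * S N G"
    if N: "N \<ge> 1" and nz: "S N (\<lambda>_. 1) \<noteq> 0" for N
  proof -
    define E where "E = T \<times> {..<N}"
    have finE: "finite E" using T by (simp add: E_def)
    define k where "k U = restrict (occupation fst U) T" for U :: "('s \<times> nat) set"
    define u where "u U = (\<Prod>s\<in>T. fact (occupation fst U s)) * a (k U)" for U
    define w where "w U = u U / real N ^ card U" for U
    \<comment> \<open>Intersecting with \<open>E\<close> keeps cardinalities finite, so that the occupation numbers are monotone in \<open>U\<close>.\<close>
    have S_wsum: "wsum E w (\<lambda>U. \<Phi> (k (U \<inter> E))) = S N \<Phi>" for \<Phi>
    proof -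
      have "wsum E w (\<lambda>U. \<Phi> (k (U \<inter> E))) = wsum E w (\<lambda>U. \<Phi> (k U))"
        by (intro wsum_cong) (auto simp: Int_absorb2)
      then show ?thesis
        using wsum_polarized[OF T, of N a \<Phi>] by (simp add: w_def[abs_def] u_def k_def S_def tr_def E_def)
    qed
    have w_nz: "wsum E w (\<lambda>_. 1) \<noteq> 0" using S_wsum[of "\<lambda>_. 1"] nz by simp
    have w_nonneg: "w U \<ge> 0" for U
      unfolding w_def u_def a_def by (intro divide_nonneg_nonneg mult_nonneg_nonneg prod_nonneg) auto
    have "\<exists>U\<in>Pow E. w U \<noteq> 0"
    proof (rule ccontr)
      assume "\<not> (\<exists>U\<in>Pow E. w U \<noteq> 0)"
      then have "wsum E w (\<lambda>_. 1) = 0" unfolding wsum_def by (intro sum.neutral) auto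
      then show False using w_nz by contradiction
    qed
    then obtain U0 where "U0 \<in> Pow E" "u U0 \<noteq> 0" unfolding w_def by force
    moreover have "u U \<ge> 0" for U
      unfolding u_def a_def by (intro mult_nonneg_nonneg prod_nonneg) auto
    ultimately have "(\<Sum>U\<in>Pow E. u U) > 0"
      using finE by (intro sum_pos2[of _ U0]) (auto simp: order.strict_iff_order)
    then have u_nz: "(\<Sum>U\<in>Pow E. complex_of_real (u U)) \<noteq> 0"
      by (metis of_real_sum of_real_eq_0_iff less_irrefl)
    have u_eq: "complex_of_real (u U) = (\<Prod>s\<in>T. fact (occupation fst U s)) * complex_of_real (a (restrict (occupation fst U) T))" for U
      by (simp add: u_def k_def)
    have "ma_stable E (\<lambda>U. complex_of_real (u U))"
      unfolding u_eq
      by (rule ma_stable_polarization_limit[OF T dc finE]) (use u_nz in \<open>auto simp: E_def u_eq\<close>)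
    from ma_stable_field[OF this, of "inverse (real N)"] N
    have w_st: "ma_stable E (\<lambda>U. of_real (w U))"
      by (simp add: w_def divide_inverse power_inverse mult.commute)
    have k_in: "k U \<in> T \<rightarrow>\<^sub>E UNIV" for U by (simp add: k_def)
    have mono': "mono (\<lambda>U. \<Phi> (k (U \<inter> E)))" if "mono_on (T \<rightarrow>\<^sub>E UNIV) \<Phi>" for \<Phi> :: "_ \<Rightarrow> real"
    proof (intro monoI mono_onD[OF that k_in k_in] le_funI)
      fix U V :: "('s \<times> nat) set" and s assume "U \<subseteq> V"
      then have "{e \<in> U \<inter> E. fst e = s} \<subseteq> {e \<in> V \<inter> E. fst e = s}" by auto
      then have "occupation fst (U \<inter> E) s \<le> occupation fst (V \<inter> E) s"
        unfolding occupation_def using finE by (intro card_mono) auto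
      then show "k (U \<inter> E) s \<le> k (V \<inter> E) s" by (simp add: k_def)
    qed
    have det': "determined_by (C \<times> {..<N}) (\<lambda>U. \<Phi> (k (U \<inter> E)))"
      if "depends_only_on T C \<Phi>" "C \<subseteq> T" for C and \<Phi> :: "_ \<Rightarrow> real"
      unfolding determined_by_def
    proof
      fix U
      have "k (U \<inter> E) s = k (U \<inter> (C \<times> {..<N}) \<inter> E) s" if "s \<in> C" for s
      proof -
        have "{e \<in> U \<inter> E. fst e = s} = {e \<in> U \<inter> (C \<times> {..<N}) \<inter> E. fst e = s}"
          using that by (auto simp: E_def)
        then show ?thesis by (simp add: k_def occupation_def)
      qed
      then show "\<Phi> (k (U \<inter> E)) = \<Phi> (k (U \<inter> (C \<times> {..<N}) \<inter> E))"
        using that(1) k_in unfolding depends_only_on_def by blast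
    qed
    have "wcov E w (\<lambda>U. F (k (U \<inter> E))) (\<lambda>U. G (k (U \<inter> E))) \<le> 0"
      by (rule stable_weights_negatively_associated[OF finE w_nonneg w_nz w_st _ _ _
            mono'[OF mono(1)] det'[OF dep(1) AB(1)] mono'[OF mono(2)] det'[OF dep(2) AB(2)]])
         (use AB in \<open>auto simp: E_def\<close>)
    then show ?thesis
      unfolding wcov_def S_wsum[of F] S_wsum[of G] S_wsum[of "\<lambda>x. F x * G x"] S_wsum[of "\<lambda>_. 1"] by simp
  qed
  have lim1: "(\<lambda>N. S N (\<lambda>_. 1)) \<longlonglongrightarrow> 1" using lim[of "\<lambda>_. 1"] by (simp add: prob_space)
  then have ev: "\<forall>\<^sub>F N in sequentially. S N (\<lambda>_. 1) \<noteq> 0"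
    by (rule tendsto_imp_eventually_ne) simp
  have "1 * (\<integral>x. F x * G x \<partial>\<nu>) \<le> (\<integral>x. F x \<partial>\<nu>) * (\<integral>x. G x \<partial>\<nu>)"
  proof (rule tendsto_le[OF trivial_limit_sequentially])
    show "(\<lambda>N. S N F * S N G) \<longlonglongrightarrow> (\<integral>x. F x \<partial>\<nu>) * (\<integral>x. G x \<partial>\<nu>)"
      by (intro tendsto_intros lim int)
    show "(\<lambda>N. S N (\<lambda>_. 1) * S N (\<lambda>x. F x * G x)) \<longlonglongrightarrow> 1 * (\<integral>x. F x * G x \<partial>\<nu>)"
      by (intro tendsto_intros lim lim1 int)
    show "\<forall>\<^sub>F N in sequentially. S N (\<lambda>_. 1) * S N (\<lambda>x. F x * G x) \<le> S N F * S N G"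
      using ev eventually_ge_at_top[of 1] by eventually_elim (rule ineq)
  qed
  then show ?thesis by simp
qed


section \<open>Countably many coordinates\<close>

definition cutoff :: "'s set \<Rightarrow> 's set \<Rightarrow> ('s \<Rightarrow> nat) \<Rightarrow> 's \<Rightarrow> nat" where
  "cutoff S T x = (\<lambda>s\<in>S. if s \<in> T then x s else 0)"

lemma cutoff_in [simp]: "cutoff S T x \<in> S \<rightarrow>\<^sub>E UNIV"
  by (simp add: cutoff_def)

lemma cutoff_restrict [simp]: "cutoff S T (restrict x T) = cutoff S T x"
  by (auto simp: cutoff_def)

lemma cutoff_mono: "x \<le> y \<Longrightarrow> cutoff S T x \<le> cutoff S T y"
  by (auto simp: cutoff_def le_fun_def)

lemma cutoff_le: "x \<in> S \<rightarrow>\<^sub>E UNIV \<Longrightarrow> cutoff S T x \<le> x"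
  by (auto simp: cutoff_def le_fun_def PiE_iff extensional_def)

lemma cutoff_ge: "cutoff S {} x \<le> cutoff S T x"
  by (auto simp: cutoff_def le_fun_def)

lemma measurable_cutoff:
  assumes "T \<subseteq> S"
  shows "cutoff S T \<in> measurable (nat_families T) (nat_families S)"
  unfolding cutoff_def
proof (rule measurable_restrict)
  fix s
  show "(\<lambda>x. if s \<in> T then x s else 0) \<in> measurable (nat_families T) (count_space UNIV)"
    by (cases "s \<in> T") (simp_all add: measurable_component_singleton)
qed

text \<open>Each coordinate is eventually kept, which is convergence in the product topology.\<close>

lemma continuous_cutoff_limit:
  fixes F :: "('s \<Rightarrow> nat) \<Rightarrow> real"
  assumes cont: "continuous_map (product_topology (\<lambda>_. discrete_topology UNIV) S) euclideanreal F"
    and x: "x \<in> S \<rightarrow>\<^sub>E UNIV" and inc: "\<And>s. s \<in> S \<Longrightarrow> \<forall>\<^sub>F n in sequentially. s \<in> Sn n"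
  shows "(\<lambda>n. F (cutoff S (Sn n) x)) \<longlonglongrightarrow> F x"
proof -
  have "limitin (product_topology (\<lambda>_. discrete_topology UNIV) S) (\<lambda>n. cutoff S (Sn n) x) x sequentially"
    unfolding limitin_componentwise
  proof (intro conjI ballI)
    show "x \<in> extensional S" using x by (simp add: PiE_iff)
    show "\<forall>\<^sub>F n in sequentially. cutoff S (Sn n) x \<in> topspace (product_topology (\<lambda>_. discrete_topology UNIV) S)"
      by simp
    fix s assume s: "s \<in> S"
    show "limitin (discrete_topology UNIV) (\<lambda>n. cutoff S (Sn n) x s) (x s) sequentially"
    proof (rule limitin_eventually)
      show "\<forall>\<^sub>F n in sequentially. cutoff S (Sn n) x s = x s"
        using inc[OF s] by (rule eventually_mono) (simp add: cutoff_def s)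
    qed simp
  qed
  from continuous_map_limit[OF cont this] show ?thesis by (simp add: o_def)
qed

theorem theorem3p6:
  fixes S :: "'s set" and \<mu> :: "('s \<Rightarrow> nat) measure"
  assumes "countable S"
    and "prob_space \<mu>"
    and "sets \<mu> = sets (nat_families S)"
    and "tstable_measure S \<mu>"
  shows "negatively_associated S \<mu>"
  unfolding negatively_associated_def
proof (intro allI impI, elim conjE)
  interpret prob_space \<mu> by fact
  fix F G :: "('s \<Rightarrow> nat) \<Rightarrow> real" and A B
  assume AB: "A \<subseteq> S" "B \<subseteq> S" "A \<inter> B = {}"
    and dep: "depends_only_on S A F" "depends_only_on S B G"
    and mono: "mono_on (S \<rightarrow>\<^sub>E UNIV) F" "mono_on (S \<rightarrow>\<^sub>E UNIV) G"
    and cont: "continuous_map (product_topology (\<lambda>_. discrete_topology UNIV) S) euclideanreal F"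
      "continuous_map (product_topology (\<lambda>_. discrete_topology UNIV) S) euclideanreal G"
    and int: "integrable \<mu> F" "integrable \<mu> G" "integrable \<mu> (\<lambda>x. F x * G x)"
  have space: "space \<mu> = S \<rightarrow>\<^sub>E UNIV" using sets_eq_imp_space_eq[OF assms(3)] by (simp add: space_PiM)
  \<comment> \<open>Finite sets exhausting \<open>S\<close>.\<close>
  define Sn where "Sn n = {s \<in> S. to_nat_on S s < n}" for n
  have Sn: "finite (Sn n)" "Sn n \<subseteq> S" for n
  proof -
    have "inj_on (to_nat_on S) (Sn n)"
      by (rule inj_on_subset[OF inj_on_to_nat_on[OF assms(1)]]) (auto simp: Sn_def)
    moreover have "finite (to_nat_on S ` Sn n)"
      by (rule finite_subset[of _ "{..<n}"]) (auto simp: Sn_def)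
    ultimately show "finite (Sn n)" by (rule finite_imageD[rotated])
  qed (auto simp: Sn_def)
  have inc: "\<forall>\<^sub>F n in sequentially. s \<in> Sn n" if "s \<in> S" for s
    unfolding Sn_def using that by (auto intro: eventually_gt_at_top)
  let ?c = "\<lambda>n. cutoff S (Sn n)"
  define z where "z = cutoff S {} (\<lambda>_. 0)"
  have cut_z: "cutoff S {} x = z" for x by (simp add: cutoff_def z_def)
  have bound: "\<bar>H (?c n x)\<bar> \<le> \<bar>H z\<bar> + \<bar>H x\<bar>"
    if "mono_on (S \<rightarrow>\<^sub>E UNIV) H" "x \<in> space \<mu>" for H :: "_ \<Rightarrow> real" and x n
  proof -
    have "H z \<le> H (?c n x)" unfolding cut_z[of x, symmetric] by (rule mono_onD[OF that(1) _ _ cutoff_ge]) auto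
    moreover have "H (?c n x) \<le> H x"
      using that(2) by (intro mono_onD[OF that(1) _ _ cutoff_le]) (auto simp: space)
    ultimately show ?thesis by linarith
  qed
  have restr: "(\<lambda>\<omega>. restrict \<omega> (Sn n)) \<in> measurable \<mu> (nat_families (Sn n))" for n
    unfolding measurable_cong_sets[OF assms(3) refl] using Sn(2) by (rule measurable_restrict_subset)
  have meas: "(\<lambda>x. H (?c n x)) \<in> borel_measurable (nat_families (Sn n))"
    if "integrable \<mu> H" for H :: "_ \<Rightarrow> real" and n
  proof -
    have "H \<in> borel_measurable (nat_families S)"
      using borel_measurable_integrable[OF that] measurable_cong_sets[OF assms(3) refl] by blast
    then show ?thesis by (rule measurable_compose[OF measurable_cutoff[OF Sn(2)]])
  qed
  have meas': "(\<lambda>x. H (?c n x)) \<in> borel_measurable \<mu>" if "integrable \<mu> H" for H :: "_ \<Rightarrow> real" and n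
    using measurable_compose[OF restr meas[OF that], of n] by simp
  have dom1: "integrable \<mu> (\<lambda>x. \<bar>H z\<bar> + \<bar>H x\<bar>)" if "integrable \<mu> H" for H :: "_ \<Rightarrow> real"
    using that by simp
  have dom2: "integrable \<mu> (\<lambda>x. (\<bar>F z\<bar> + \<bar>F x\<bar>) * (\<bar>G z\<bar> + \<bar>G x\<bar>))"
  proof -
    have "integrable \<mu> (\<lambda>x. \<bar>F z\<bar> * \<bar>G z\<bar> + \<bar>F z\<bar> * \<bar>G x\<bar> + \<bar>G z\<bar> * \<bar>F x\<bar> + \<bar>F x * G x\<bar>)"
      using int by (intro Bochner_Integration.integrable_add integrable_mult_right integrable_abs) auto
    then show ?thesis by (simp add: algebra_simps abs_mult)
  qed
  have bound2: "\<bar>F (?c n x) * G (?c n x)\<bar> \<le> (\<bar>F z\<bar> + \<bar>F x\<bar>) * (\<bar>G z\<bar> + \<bar>G x\<bar>)" if "x \<in> space \<mu>" for n x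
    unfolding abs_mult by (intro mult_mono bound mono that) auto
  have ptw: "AE x in \<mu>. (\<lambda>n. H (?c n x)) \<longlonglongrightarrow> H x"
    if "continuous_map (product_topology (\<lambda>_. discrete_topology UNIV) S) euclideanreal H" for H :: "_ \<Rightarrow> real"
    by (rule AE_I2) (use continuous_cutoff_limit[OF that _ inc] space in auto)
  have lim: "(\<lambda>n. \<integral>x. H (?c n x) \<partial>\<mu>) \<longlonglongrightarrow> (\<integral>x. H x \<partial>\<mu>)"
    if "integrable \<mu> H" "mono_on (S \<rightarrow>\<^sub>E UNIV) H"
      "continuous_map (product_topology (\<lambda>_. discrete_topology UNIV) S) euclideanreal H" for H :: "_ \<Rightarrow> real"
    by (rule integral_dominated_convergence[OF _ _ dom1[OF that(1)] ptw[OF that(3)]])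
       (use that bound[OF that(2)] meas' in auto)
  have limFG: "(\<lambda>n. \<integral>x. F (?c n x) * G (?c n x) \<partial>\<mu>) \<longlonglongrightarrow> (\<integral>x. F x * G x \<partial>\<mu>)"
  proof (rule integral_dominated_convergence[OF _ _ dom2])
    show "AE x in \<mu>. (\<lambda>n. F (?c n x) * G (?c n x)) \<longlonglongrightarrow> F x * G x"
      using ptw[OF cont(1)] ptw[OF cont(2)] by eventually_elim (rule tendsto_mult)
  qed (use int bound2 meas' in auto)
  have "(\<integral>x. F (?c n x) * G (?c n x) \<partial>\<mu>) \<le> (\<integral>x. F (?c n x) \<partial>\<mu>) * (\<integral>x. G (?c n x) \<partial>\<mu>)" for n
  proof -
    define \<nu> where "\<nu> = distr \<mu> (nat_families (Sn n)) (\<lambda>\<omega>. restrict \<omega> (Sn n))"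
    have transfer: "(\<integral>x. H (?c n x) \<partial>\<nu>) = (\<integral>x. H (?c n x) \<partial>\<mu>)"
      "integrable \<mu> (\<lambda>x. H (?c n x)) \<Longrightarrow> integrable \<nu> (\<lambda>x. H (?c n x))"
      if "(\<lambda>x. H (?c n x)) \<in> borel_measurable (nat_families (Sn n))" for H :: "_ \<Rightarrow> real"
      unfolding \<nu>_def integral_distr[OF restr that] integrable_distr_eq[OF restr that] by simp_all
    have intn: "integrable \<mu> (\<lambda>x. F (?c n x))" "integrable \<mu> (\<lambda>x. G (?c n x))"
      "integrable \<mu> (\<lambda>x. F (?c n x) * G (?c n x))"
      using Bochner_Integration.integrable_bound[OF dom1[OF int(1)] meas'[OF int(1)]]
        Bochner_Integration.integrable_bound[OF dom1[OF int(2)] meas'[OF int(2)]]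
        Bochner_Integration.integrable_bound[OF dom2 borel_measurable_times[OF meas'[OF int(1)] meas'[OF int(2)]]]
        bound[OF mono(1)] bound[OF mono(2)] bound2 by (auto intro!: AE_I2)
    have mono': "mono_on (Sn n \<rightarrow>\<^sub>E UNIV) (\<lambda>x. H (?c n x))" if "mono_on (S \<rightarrow>\<^sub>E UNIV) H" for H :: "_ \<Rightarrow> real"
      by (intro mono_onI mono_onD[OF that] cutoff_mono) auto
    have dep': "depends_only_on (Sn n) (C \<inter> Sn n) (\<lambda>x. H (?c n x))" if "depends_only_on S C H" "C \<subseteq> S"
      for C and H :: "_ \<Rightarrow> real"
      unfolding depends_only_on_def
    proof (intro ballI impI)
      fix x y :: "'s \<Rightarrow> nat" assume "\<forall>s\<in>C \<inter> Sn n. x s = y s"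
      then have "\<forall>s\<in>C. ?c n x s = ?c n y s" using that(2) by (auto simp: cutoff_def)
      then show "H (?c n x) = H (?c n y)" using that(1) unfolding depends_only_on_def by simp
    qed
    have FG_meas: "(\<lambda>x. F (?c n x) * G (?c n x)) \<in> borel_measurable (nat_families (Sn n))"
      using meas int by simp
    have "(\<integral>x. F (?c n x) * G (?c n x) \<partial>\<nu>) \<le> (\<integral>x. F (?c n x) \<partial>\<nu>) * (\<integral>x. G (?c n x) \<partial>\<nu>)"
    proof (rule finite_negatively_associated[OF Sn(1)])
      show "prob_space \<nu>" unfolding \<nu>_def by (rule prob_space_distr[OF restr])
      show "sets \<nu> = sets (nat_families (Sn n))" by (simp add: \<nu>_def)
      show "tstable_measure_fin (Sn n) \<nu>"
        using assms(4) Sn unfolding tstable_measure_def \<nu>_def by blast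
      show "A \<inter> Sn n \<inter> (B \<inter> Sn n) = {}" using AB(3) by auto
      show "integrable \<nu> (\<lambda>x. F (?c n x) * G (?c n x))"
        using transfer(2)[of "\<lambda>x. F x * G x"] FG_meas intn by simp
      show "integrable \<nu> (\<lambda>x. F (?c n x))" by (rule transfer(2)[of F, OF meas[OF int(1)] intn(1)])
      show "integrable \<nu> (\<lambda>x. G (?c n x))" by (rule transfer(2)[of G, OF meas[OF int(2)] intn(2)])
    qed (use dep'[OF dep(1) AB(1)] dep'[OF dep(2) AB(2)] mono'[OF mono(1)] mono'[OF mono(2)] in auto)
    then show ?thesis
      using transfer(1)[of F, OF meas[OF int(1)]] transfer(1)[of G, OF meas[OF int(2)]]
        transfer(1)[of "\<lambda>x. F x * G x"] FG_meas
      by simp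
  qed
  then show "(\<integral>x. F x * G x \<partial>\<mu>) \<le> (\<integral>x. F x \<partial>\<mu>) * (\<integral>x. G x \<partial>\<mu>)"
    using LIMSEQ_le[OF limFG tendsto_mult[OF lim[OF int(1) mono(1) cont(1)] lim[OF int(2) mono(2) cont(2)]]] by blast
qed

end
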